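(* Let $d\ge 2$, let $a\ge 1$ be an integer, and let $\mathbb{P}$ be a translation-invariant law on environments $\omega\in\overline{\mathbb{R}}^{\mathbb{Z}^d}$. Let $F$ be an update function that is non-decreasing in all its coordinates and satisfies $F(a_1,\dots,a_{2(d-1)},-\infty)=0$ for all $a_1,\dots,a_{2(d-1)}$. Let $\gamma$ be an integer with $\gamma>d+2a$, let $D$ be an integer with $D>2\gamma$, and let $\alpha,\rho>0$ satisfy $$\alpha(a+1)>2Dd(\gamma-1)\qquad\text{and}\qquad \rho>d(\gamma-1)(1+2\gamma).$$ Suppose that $\mathbb{P}$ satisfies the mixing condition $\mathrm{Mix}(D,\alpha,c_1)$ for some $c_1>0$, and that the finite size criterion $\mathrm{FS}(h,\rho,c_2)$ holds for some integer $h\ge 2$ and some $c_2>0$. Let $(S_t)_{t\ge0}$ be the evolution in the environment $\omega$ started from the flat surface $S_0(x)=0$ for every $x\in\mathbb{Z}^{d-1}$. Then there exists a constant $c>0$, depending only on $\alpha,d,D,h,\gamma,c_1,c_2$, such that $$\liminf_{t\to\infty}\frac{S_t(0)}{t}\ \ge\ c,\qquad \mathbb{P}\text{-almost surely.}$$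
   Context: **Environment.** Points of $\mathbb{Z}^d$ are written $(x,z)$ with $x\in\mathbb{Z}^{d-1}$, $z\in\mathbb{Z}$. $\overline{\mathbb{R}}=\mathbb{R}\cup\{-\infty\}$, $\overline{\mathbb{Z}}=\mathbb{Z}\cup\{-\infty\}$. An environment is $\omega\in\Omega=\overline{\mathbb{R}}^{\mathbb{Z}^d}$ (product $\sigma$-algebra), and $\mathbb{P}$ is a probability measure on $\Omega$ invariant under translations of $\mathbb{Z}^d$. **Mixing condition $\mathrm{Mix}(D,\alpha,c_1)$.** For all $L\ge c_1$, all cubes $C_1,\dots,C_D\subset\mathbb{Z}^d$ of side length $3L$ with mutual (sup-norm) distance at least $L$, and all measurable $f_i:\overline{\mathbb{R}}^{C_i}\to[0,1]$ (viewed as functions of $\omega$ restricted to $C_i$), $i=1,\dots,D$, $$\mathbb{E}[f_1\cdots f_D]\le \mathbb{E}[f_1]\cdots\mathbb{E}[f_D]+L^{-\alpha}.$$ **Dynamics.** A surface is any function $S:\mathbb{Z}^{d-1}\to\overline{\mathbb{Z}}$. Let $E=\{\pm e_k:k=1,\dots,d-1\}$ and $\partial_eS(x)=S(x+e)-S(x)$. Given an update function $F:\mathbb{Z}^E\times\overline{\mathbb{R}}\to\{0,1\}$, the evolution in the environment $\omega$ is $$S_{t+1}(x)=S_t(x)+F\big(\partial_{e_1}S_t(x),\partial_{-e_1}S_t(x),\dots,\partial_{e_{d-1}}S_t(x),\partial_{-e_{d-1}}S_t(x);\ \omega(x,S_t(x))\big),\quad t=0,1,2,\dots$$ Conventions: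 $-\infty+1=-\infty$ (so $S_{t+1}(x)=-\infty$ if $S_t(x)=-\infty$), and $F=0$ if some partial derivative equals $-\infty$. $S$ is obstructed at $x$ (in a given environment) if one step of this rule started from $S$ does not change the value at $x$. **Boxes.** With $H_L=L^{a+1}$, for integers $h,L\ge1$, $$C^{h,L}=\big([0,3hL)^{d-1}\times[0,H_L)\big)\cap\mathbb{Z}^d,\qquad B^{h,L}=\big([hL,2hL)^{d-1}\times[0,L)\big)\cap\mathbb{Z}^d .$$ **Blocking.** A surface $S$ blocks $C^{h,L}$ if: (1) the graph of $S$ intersects $B^{h,L}$; (2) $S(x)\ge0$ for every $x\in[0,3hL)^{d-1}$; (3) for every $x\in[0,3hL)^{d-1}$ with $S(x)\le H_L$, $S$ is obstructed at $x$, in the environment equal to $\omega$ on $C^{h,L}$ and to $-\infty$ outside $C^{h,L}$. **Finite size criterion $\mathrm{FS}(h,\rho,c_2)$.** For every integer $L\ge c_2$, $\mathbb{P}[\text{there exists a surface }S\text{ blocking }C^{h,L}]\le L^{-\rho}$. *)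

theory Defs
  imports "HOL-Probability.Probability"
begin

text \<open>
  The dimension is \<open>d = CARD('n) + 1\<close>: horizontal positions are vectors \<open>x :: int ^ 'n\<close>, and a point of
  the lattice is a pair \<open>(x, z)\<close>.
\<close>

type_synonym 'n site = "(int ^ 'n) \<times> int"
type_synonym 'n environment = "'n site \<Rightarrow> ereal"

text \<open>
  The values of an environment are real or \<open>-\<infinity>\<close>.  The type \<open>ereal\<close> also contains \<open>\<infinity>\<close>, which is
  removed here, so that the points of \<open>Omega\<close> are exactly the functions that avoid the value \<open>\<infinity>\<close>.
\<close>

definition Rbar :: "ereal measure" where
  "Rbar = restrict_space borel {..<\<infinity>}"

definition Omega :: "'n::finite environment measure" where
  "Omega = (\<Pi>\<^sub>M p\<in>UNIV. Rbar)"

definition shift :: "'n::finite site \<Rightarrow> 'n environment \<Rightarrow> 'n environment" where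
  "shift v \<omega> = (\<lambda>p. \<omega> (p + v))"

definition translation_invariant_law :: "'n::finite environment measure \<Rightarrow> bool" where
  "translation_invariant_law P \<longleftrightarrow>
     prob_space P \<and> sets P = sets Omega \<and> (\<forall>v. distr P P (shift v) = P)"


subsection \<open>Mixing\<close>

definition sup_dist :: "'n::finite site \<Rightarrow> 'n site \<Rightarrow> int" where
  "sup_dist p q = max (MAX k. \<bar>fst p $ k - fst q $ k\<bar>) \<bar>snd p - snd q\<bar>"

definition cube :: "'n::finite site \<Rightarrow> nat \<Rightarrow> 'n site set" where
  "cube p s = {q. (\<forall>k. fst p $ k \<le> fst q $ k \<and> fst q $ k < fst p $ k + int s) \<and>
                  snd p \<le> snd q \<and> snd q < snd p + int s}"

definition Mix :: "'n::finite environment measure \<Rightarrow> nat \<Rightarrow> real \<Rightarrow> real \<Rightarrow> bool" where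
  "Mix P D \<alpha> c1 \<longleftrightarrow>
     (\<forall>(L::nat) (C :: nat \<Rightarrow> 'n site set) (f :: nat \<Rightarrow> 'n environment \<Rightarrow> real).
        real L \<ge> c1 \<longrightarrow>
        (\<forall>i<D. \<exists>p. C i = cube p (3 * L)) \<longrightarrow>
        (\<forall>i<D. \<forall>j<D. i \<noteq> j \<longrightarrow> (\<forall>p\<in>C i. \<forall>q\<in>C j. sup_dist p q \<ge> int L)) \<longrightarrow>
        (\<forall>i<D. f i \<in> borel_measurable (\<Pi>\<^sub>M p\<in>C i. Rbar) \<and>
               (\<forall>\<eta>\<in>space (\<Pi>\<^sub>M p\<in>C i. Rbar). 0 \<le> f i \<eta> \<and> f i \<eta> \<le> 1)) \<longrightarrow>
        (\<integral>\<omega>. (\<Prod>i<D. f i (restrict \<omega> (C i))) \<partial>P)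
          \<le> (\<Prod>i<D. \<integral>\<omega>. f i (restrict \<omega> (C i)) \<partial>P) + real L powr (- \<alpha>))"


subsection \<open>Dynamics\<close>

datatype zbar = MInf | Fin (the_Fin: int)

primrec ereal_of_zbar :: "zbar \<Rightarrow> ereal" where
  "ereal_of_zbar MInf = -\<infinity>"
| "ereal_of_zbar (Fin z) = ereal (real_of_int z)"

type_synonym 'n surface = "int ^ 'n \<Rightarrow> zbar"

text \<open>
  The set of directions \<open>\<plusminus>e\<^sub>k\<close> is encoded by \<open>'n \<times> bool\<close>, the Boolean being the sign.
\<close>

definition dir :: "'n::finite \<times> bool \<Rightarrow> int ^ 'n" where
  "dir e = (if snd e then axis (fst e) 1 else - axis (fst e) 1)"

type_synonym 'n update = "('n \<times> bool \<Rightarrow> int) \<Rightarrow> ereal \<Rightarrow> nat"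

text \<open>
  The environment argument of an update function ranges over the reals and \<open>-\<infinity>\<close>; nothing is required
  at \<open>\<infinity>\<close>.
\<close>

definition update_function :: "'n::finite update \<Rightarrow> bool" where
  "update_function F \<longleftrightarrow> (\<forall>u. \<forall>r<\<infinity>. F u r \<in> {0, 1})"

definition nondecreasing_update :: "'n::finite update \<Rightarrow> bool" where
  "nondecreasing_update F \<longleftrightarrow>
     (\<forall>u v r s. (\<forall>e. u e \<le> v e) \<longrightarrow> r \<le> s \<longrightarrow> s < \<infinity> \<longrightarrow> F u r \<le> F v s)"

text \<open>
  If a neighbour of \<open>x\<close> has height \<open>-\<infinity>\<close> and \<open>S x\<close> is finite, some partial derivative is \<open>-\<infinity>\<close> and by
  convention the update is \<open>0\<close>.
\<close>

definition step :: "'n::finite update \<Rightarrow> 'n environment \<Rightarrow> 'n surface \<Rightarrow> 'n surface" where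
  "step F \<omega> S x =
     (case S x of
        MInf \<Rightarrow> MInf
      | Fin z \<Rightarrow>
          (if \<exists>e. S (x + dir e) = MInf then Fin z
           else Fin (z + int (F (\<lambda>e. the_Fin (S (x + dir e)) - z) (\<omega> (x, z))))))"

definition evolution :: "'n::finite update \<Rightarrow> 'n environment \<Rightarrow> 'n surface \<Rightarrow> nat \<Rightarrow> 'n surface" where
  "evolution F \<omega> S0 t = (step F \<omega> ^^ t) S0"

definition flat_surface :: "'n::finite surface" where
  "flat_surface = (\<lambda>x. Fin 0)"

definition obstructed_at :: "'n::finite update \<Rightarrow> 'n environment \<Rightarrow> 'n surface \<Rightarrow> int ^ 'n \<Rightarrow> bool" where
  "obstructed_at F \<omega> S x \<longleftrightarrow> step F \<omega> S x = S x"


subsection \<open>Boxes and blocking\<close>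

definition base :: "nat \<Rightarrow> nat \<Rightarrow> (int ^ 'n::finite) set" where
  "base h L = {x. \<forall>k. 0 \<le> x $ k \<and> x $ k < int (3 * h * L)}"

definition height :: "nat \<Rightarrow> nat \<Rightarrow> nat" where
  "height a L = L ^ (a + 1)"

definition box_C :: "nat \<Rightarrow> nat \<Rightarrow> nat \<Rightarrow> 'n::finite site set" where
  "box_C a h L = base h L \<times> {0..<int (height a L)}"

definition box_B :: "nat \<Rightarrow> nat \<Rightarrow> 'n::finite site set" where
  "box_B h L = {x. \<forall>k. int (h * L) \<le> x $ k \<and> x $ k < int (2 * h * L)} \<times> {0..<int L}"

definition graph_of :: "'n::finite surface \<Rightarrow> 'n site set" where
  "graph_of S = {(x, z). S x = Fin z}"

definition env_in :: "'n::finite site set \<Rightarrow> 'n environment \<Rightarrow> 'n environment" where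
  "env_in C \<omega> = (\<lambda>p. if p \<in> C then \<omega> p else -\<infinity>)"

definition blocks :: "'n::finite update \<Rightarrow> nat \<Rightarrow> nat \<Rightarrow> nat \<Rightarrow> 'n environment \<Rightarrow> 'n surface \<Rightarrow> bool" where
  "blocks F a h L \<omega> S \<longleftrightarrow>
     graph_of S \<inter> box_B h L \<noteq> {} \<and>
     (\<forall>x\<in>base h L. ereal_of_zbar (S x) \<ge> 0) \<and>
     (\<forall>x\<in>base h L. ereal_of_zbar (S x) \<le> ereal (real (height a L)) \<longrightarrow>
        obstructed_at F (env_in (box_C a h L) \<omega>) S x)"

text \<open>
  The event below is measurable when \<open>F\<close> is non-decreasing: blocking depends on \<open>S\<close> only through its
  values at finitely many positions, so the event is a countable union of finite intersections of
  sets \<open>{\<omega>. F u (\<omega> p) = 0}\<close>.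
\<close>

definition FS :: "'n::finite update \<Rightarrow> nat \<Rightarrow> 'n environment measure \<Rightarrow> nat \<Rightarrow> real \<Rightarrow> real \<Rightarrow> bool" where
  "FS F a P h \<rho> c2 \<longleftrightarrow>
     (\<forall>L::nat. real L \<ge> c2 \<longrightarrow>
        measure P {\<omega> \<in> space P. \<exists>S. blocks F a h L \<omega> S} \<le> real L powr (- \<rho>))"

end

theory Submission
  imports Defs
begin

text \<open>
  Everything rests on one monotonicity property: raising the surface or the environment raises the
  surface after one step, hence at all later times (\<open>step_mono\<close>). So the growth in a
  box can be bounded from below by the surface that starts at \<open>0\<close> on the base of the
  box and at \<open>-\<infinity>\<close> off it, in the environment erased outside the box. The
  box is said to be crossed in time \<open>T\<close> if this surface is above \<open>L\<close>
  over the middle third of the base at time \<open>T\<close>.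

  Blocking is the failure to cross at all. The evolution in a finite box freezes after at most as
  many steps as the box has points, the frozen surface blocks the box unless the box has been
  crossed, and a blocking surface is never passed (\<open>blocked_iff_not_crosses\<close>). The
  finite size criterion thus says that boxes of side \<open>L\<close> are crossed in a crude time
  of order \<open>L ^ (d + a)\<close> except with probability \<open>L ^ (- \<rho>)\<close>. That
  time is far too long for a positive speed, and it is improved by renormalisation.

  A box of side \<open>L ^ \<gamma>\<close> is cut into \<open>N = L ^ (\<gamma> - 1)\<close>
  levels of translates of the box of side \<open>L\<close>. When all the boxes of a level are
  crossed in time \<open>T\<close>, the surface climbs that level in time \<open>T\<close>, at the
  price of one cell of width on each side; after \<open>N\<close> levels the middle third of the
  large base is left. Levels with a box that is not crossed in time \<open>T\<close> are slow, and
  there one waits for the crude time. Either there are fewer than \<open>4 D L ^ a\<close> slow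
  levels, or \<open>D\<close> of them are so far apart that the mixing condition treats slow boxes
  in them as independent. In the first case the delay is of order \<open>L ^ (d + 2 a)\<close>, at
  most a constant times \<open>L ^ \<gamma> / L\<close>, so along the scales \<open>L, L ^
  \<gamma>, L ^ (\<gamma>\<^sup>2), ...\<close> the inverse speeds increase by summable amounts
  and stay bounded (\<open>crossing_time_le\<close>). The probability of the second case, and that
  of a box not crossed in the crude time, are bounded by counting boxes; the conditions on
  \<open>\<gamma>\<close>, \<open>D\<close>, \<open>\<alpha>\<close> and \<open>\<rho>\<close> are
  what is needed for a bound \<open>L ^ (- r)\<close> on the probability of a slow box to
  reproduce itself from one scale to the next (\<open>decay_recursion\<close>,
  \<open>crossing_probability\<close>).

  Finally \<open>r\<close> exceeds the exponent of the number of boxes in a pyramid over the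
  origin, so that almost surely no such pyramid contains a slow box from some scale on. Between
  two consecutive crossing times the flat surface then climbs at a speed bounded below by a
  constant that is the same for all scales and does not depend on \<open>a\<close>,
  \<open>\<rho>\<close>, \<open>P\<close> or \<open>F\<close> (\<open>ballistic_bound\<close>,
  \<open>liminf_speed\<close>).
\<close>

section \<open>Order and monotonicity of the dynamics\<close>

definition proper :: "'n::finite environment \<Rightarrow> bool" where
  "proper \<omega> \<longleftrightarrow> (\<forall>p. \<omega> p < \<infinity>)"

lemma properD: "proper \<omega> \<Longrightarrow> \<omega> p < \<infinity>"
  unfolding proper_def by blast

lemma proper_le: "\<omega> \<le> \<omega>' \<Longrightarrow> proper \<omega>' \<Longrightarrow> proper \<omega>"
  unfolding proper_def le_fun_def using order.strict_trans1 by blast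

lemma proper_env_in: "proper \<omega> \<Longrightarrow> proper (env_in C \<omega>)"
  by (simp add: proper_def env_in_def)

lemma proper_shift: "proper \<omega> \<Longrightarrow> proper (shift v \<omega>)"
  unfolding proper_def shift_def by blast

text \<open>
  A comparison with \<open>-\<infinity>\<close> on the right fails, so that this one predicate
  says both that a height is finite and that it is large.
\<close>

definition above :: "int \<Rightarrow> zbar \<Rightarrow> bool" where
  "above z s \<longleftrightarrow> (\<exists>z'. s = Fin z' \<and> z \<le> z')"

definition surface_le :: "'n::finite surface \<Rightarrow> 'n surface \<Rightarrow> bool" where
  "surface_le S S' \<longleftrightarrow> (\<forall>x z. S x = Fin z \<longrightarrow> above z (S' x))"

lemma above_Fin [simp]: "above z (Fin z') \<longleftrightarrow> z \<le> z'"
  by (simp add: above_def)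

lemma not_above_MInf [simp]: "\<not> above z MInf"
  by (simp add: above_def)

lemma above_weaken: "above z s \<Longrightarrow> z' \<le> z \<Longrightarrow> above z' s"
  by (auto simp: above_def)

lemma surface_le_refl: "surface_le S S"
  by (simp add: surface_le_def)

lemma above_surface_le: "surface_le S S' \<Longrightarrow> above z (S x) \<Longrightarrow> above z (S' x)"
  by (cases "S x") (auto simp: surface_le_def intro: above_weaken)

lemma surface_le_trans: "surface_le S S' \<Longrightarrow> surface_le S' S'' \<Longrightarrow> surface_le S S''"
  unfolding surface_le_def using above_surface_le[unfolded surface_le_def] by blast

lemma above_iff_ereal: "above z s \<longleftrightarrow> ereal (of_int z) \<le> ereal_of_zbar s"
  by (cases s) auto

lemma evolution_0 [simp]: "evolution F \<omega> S 0 = S"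
  by (simp add: evolution_def)

lemma evolution_Suc: "evolution F \<omega> S (Suc t) = step F \<omega> (evolution F \<omega> S t)"
  by (simp add: evolution_def)

lemma evolution_add: "evolution F \<omega> S (s + t) = evolution F \<omega> (evolution F \<omega> S s) t"
  by (simp add: evolution_def add.commute[of s] funpow_add)

lemma step_MInf_iff [simp]: "step F \<omega> S x = MInf \<longleftrightarrow> S x = MInf"
  by (auto simp: step_def split: zbar.splits)

lemma evolution_MInf_iff [simp]: "evolution F \<omega> S t x = MInf \<longleftrightarrow> S x = MInf"
  by (induction t) (auto simp: evolution_Suc)

definition translate :: "'n::finite site \<Rightarrow> 'n surface \<Rightarrow> 'n surface" where
  "translate v S = (\<lambda>x. case S (x + fst v) of MInf \<Rightarrow> MInf | Fin z \<Rightarrow> Fin (z - snd v))"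

lemma above_translate [simp]: "above z (translate v S x) \<longleftrightarrow> above (z + snd v) (S (x + fst v))"
  by (auto simp: translate_def split: zbar.splits)

text \<open>
  The rule sees only height differences and the environment at the current height, hence it
  commutes with translations of space.
\<close>

lemma step_translate: "step F (shift v \<omega>) (translate v S) = translate v (step F \<omega> S)"
proof
  fix x
  have comm: "x + dir e + fst v = x + fst v + dir e" for e :: "'a \<times> bool"
    by (simp add: add_ac)
  show "step F (shift v \<omega>) (translate v S) x = translate v (step F \<omega> S) x"
  proof (cases "S (x + fst v)")
    case MInf
    then show ?thesis by (simp add: step_def translate_def)
  next
    case (Fin z)
    show ?thesis
    proof (cases "\<exists>e. S (x + fst v + dir e) = MInf")
      case True
      then show ?thesis using Fin
        by (auto simp: step_def translate_def comm split: zbar.splits)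
    next
      case False
      then have "\<forall>e. \<exists>u. S (x + fst v + dir e) = zbar.Fin u"
        by (metis zbar.exhaust)
      then obtain u where u: "\<And>e. S (x + fst v + dir e) = zbar.Fin (u e)" by metis
      have "shift v \<omega> (x, z - snd v) = \<omega> (x + fst v, z)"
        by (cases v) (simp add: shift_def)
      then show ?thesis using Fin
        by (simp add: step_def translate_def comm u)
    qed
  qed
qed

lemma evolution_translate:
  "evolution F (shift v \<omega>) (translate v S) t = translate v (evolution F \<omega> S t)"
  by (induction t) (simp_all add: evolution_Suc step_translate)

locale dynamics =
  fixes F :: "'n::finite update"
  assumes update: "update_function F"
    and mono: "nondecreasing_update F"
    and blocked_site: "F u (-\<infinity>) = 0"
begin

lemma F_cases: "r < \<infinity> \<Longrightarrow> F u r = 0 \<or> F u r = 1"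
  using update by (auto simp: update_function_def)

lemma F_mono: "(\<And>e. u e \<le> v e) \<Longrightarrow> r \<le> s \<Longrightarrow> s < \<infinity> \<Longrightarrow> F u r \<le> F v s"
  using mono by (simp add: nondecreasing_update_def)

lemma step_cases:
  assumes "S x = Fin z" "proper \<omega>"
  shows "step F \<omega> S x = Fin z \<or> step F \<omega> S x = Fin (z + 1)"
  using assms F_cases[OF properD[OF assms(2), of "(x, z)"], of "\<lambda>e. the_Fin (S (x + dir e)) - z"] by (auto simp: step_def)

text \<open>
  Where the lower surface is strictly below, it gains at most one unit and cannot overtake; where
  the two touch, every slope of the upper surface is at least that of the lower one, so that the
  monotonicity of \<open>F\<close> applies. Every comparison below, between environments as
  between initial surfaces, is an instance of this.
\<close>

lemma step_mono:
  assumes le: "surface_le S S'" and env: "\<omega> \<le> \<omega>'" and fin: "proper \<omega>'"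
  shows "surface_le (step F \<omega> S) (step F \<omega>' S')"
  unfolding surface_le_def
proof (intro allI impI)
  fix x z1
  assume z1: "step F \<omega> S x = Fin z1"
  have fin': "proper \<omega>" using proper_le[OF env fin] .
  obtain z where z: "S x = Fin z" using z1 by (cases "S x") (auto simp: step_def)
  obtain z' where z': "S' x = Fin z'" "z \<le> z'"
    using le z by (auto simp: surface_le_def above_def)
  show "above z1 (step F \<omega>' S' x)"
  proof (cases "z < z'")
    case True
    then show ?thesis
      using step_cases[of S x z \<omega>, OF z fin'] step_cases[of S' x z' \<omega>', OF z'(1) fin] z1 by auto
  next
    case False
    then have [simp]: "z' = z" using z' by simp
    show ?thesis
    proof (cases "\<exists>e. S (x + dir e) = MInf")
      case True
      then have "z1 = z" using z1 z by (auto simp: step_def)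
      then show ?thesis using step_cases[of S' x z' \<omega>', OF z'(1) fin] by auto
    next
      case False
      then have "\<forall>e. \<exists>u. S (x + dir e) = Fin u" by (metis zbar.exhaust)
      then obtain u where u: "\<And>e. S (x + dir e) = Fin (u e)" by metis
      have "\<exists>u'. S' (x + dir e) = Fin u' \<and> u e \<le> u'" for e
        using le u by (auto simp: surface_le_def above_def)
      then obtain u' where u': "\<And>e. S' (x + dir e) = Fin (u' e)" "\<And>e. u e \<le> u' e" by metis
      have "F (\<lambda>e. u e - z) (\<omega> (x, z)) \<le> F (\<lambda>e. u' e - z) (\<omega>' (x, z))"
        using u' env fin by (intro F_mono) (auto simp: le_fun_def proper_def)
      then show ?thesis using z1 z z' by (auto simp: step_def u u')
    qed
  qed
qed

lemma evolution_mono: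
  assumes "surface_le S S'" "\<omega> \<le> \<omega>'" "proper \<omega>'"
  shows "surface_le (evolution F \<omega> S t) (evolution F \<omega>' S' t)"
  using assms by (induction t) (auto simp: evolution_Suc intro: step_mono)

lemma step_increasing:
  assumes "proper \<omega>"
  shows "surface_le S (step F \<omega> S)"
  unfolding surface_le_def
proof (intro allI impI)
  fix x z assume "S x = Fin z"
  then show "above z (step F \<omega> S x)" using step_cases[of S x z \<omega>] assms by auto
qed

lemma evolution_increasing:
  assumes fin: "proper \<omega>" and "s \<le> t"
  shows "surface_le (evolution F \<omega> S s) (evolution F \<omega> S t)"
  using \<open>s \<le> t\<close>
proof (induction rule: dec_induct)
  case base
  show ?case by (rule surface_le_refl)
next
  case (step t)
  then show ?case
    using step_increasing[OF fin] by (auto simp: evolution_Suc intro: surface_le_trans)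
qed

end

section \<open>Crossing a box, and its equivalence with the absence of blocking\<close>

definition middle :: "nat \<Rightarrow> nat \<Rightarrow> (int ^ 'n::finite) set" where
  "middle h L = {x. \<forall>k. int (h * L) \<le> x $ k \<and> x $ k < int (2 * h * L)}"

lemma middle_subset_base: "middle h L \<subseteq> base h L"
  unfolding middle_def base_def
proof (safe)
  fix x :: "int^'n" and k
  assume "\<forall>k. int (h * L) \<le> x $ k \<and> x $ k < int (2 * h * L)"
  then have "int (h * L) \<le> x $ k" "x $ k < int (2 * h * L)" by auto
  moreover have "int (2 * h * L) = 2 * int (h * L)" "int (3 * h * L) = 3 * int (h * L)" by auto
  moreover have "0 \<le> int (h * L)" by simp
  ultimately show "0 \<le> x $ k" "x $ k < int (3 * h * L)" by linarith+
qed

text \<open>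
  The lowest initial surface that is nonnegative on the base. As heights
  \<open>-\<infinity>\<close> also freeze their neighbours, a box that this surface crosses is
  crossed whatever happens around the box.
\<close>

definition floor_surface :: "nat \<Rightarrow> nat \<Rightarrow> 'n::finite surface" where
  "floor_surface h L = (\<lambda>x. if x \<in> base h L then Fin 0 else MInf)"

text \<open>
  The event that is followed through the scales: the middle third of the box is raised by
  \<open>L\<close> within time \<open>T\<close>, using the environment inside the box only.
\<close>

definition crosses :: "'n::finite update \<Rightarrow> nat \<Rightarrow> nat \<Rightarrow> nat \<Rightarrow> nat \<Rightarrow> 'n environment \<Rightarrow> bool" where
  "crosses F a h L T \<omega> \<longleftrightarrow>
     (\<forall>x\<in>middle h L. above (int L) (evolution F (env_in (box_C a h L) \<omega>) (floor_surface h L) T x))"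

lemma crosses_cong:
  assumes "\<And>p. p \<in> box_C a h L \<Longrightarrow> \<omega> p = \<omega>' p"
  shows "crosses F a h L T \<omega> \<longleftrightarrow> crosses F a h L T \<omega>'"
proof -
  have "env_in (box_C a h L) \<omega> = env_in (box_C a h L) \<omega>'"
    using assms by (auto simp: env_in_def)
  then show ?thesis by (simp add: crosses_def)
qed

lemma finite_int_box:
  fixes A :: "int set"
  assumes "finite A"
  shows "finite {x :: int ^ 'n::finite. \<forall>k. x $ k \<in> A}"
    and "card {x :: int ^ 'n. \<forall>k. x $ k \<in> A} = card A ^ CARD('n)"
proof -
  have "bij_betw vec_lambda ((UNIV :: 'n set) \<rightarrow>\<^sub>E A) {x :: int ^ 'n. \<forall>k. x $ k \<in> A}"
    by (rule bij_betwI[where g = vec_nth]) auto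
  moreover have "finite ((UNIV :: 'n set) \<rightarrow>\<^sub>E A)" using assms by (simp add: finite_PiE)
  moreover have "card ((UNIV :: 'n set) \<rightarrow>\<^sub>E A) = card A ^ CARD('n)"
    by (simp add: card_PiE)
  ultimately show "finite {x :: int ^ 'n::finite. \<forall>k. x $ k \<in> A}"
    and "card {x :: int ^ 'n. \<forall>k. x $ k \<in> A} = card A ^ CARD('n)"
    using bij_betw_finite bij_betw_same_card by (blast, metis)
qed

lemma base_eq: "base h L = {x. \<forall>k. x $ k \<in> {0..<int (3 * h * L)}}"
  by (auto simp: base_def)

lemma finite_base: "finite (base h L :: (int ^ 'n::finite) set)"
  unfolding base_eq by (rule finite_int_box) simp

lemma card_base: "card (base h L :: (int ^ 'n::finite) set) = (3 * h * L) ^ CARD('n)"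
  unfolding base_eq by (subst finite_int_box(2)) (simp_all only: finite_atLeastLessThan_int card_atLeastLessThan_int, simp del: of_nat_mult)

text \<open>
  The volume of the box. At every step before it freezes, the evolution in the box raises some
  column by one unit, hence it freezes within that time.
\<close>

definition crude_time :: "nat \<Rightarrow> nat \<Rightarrow> nat \<Rightarrow> nat \<Rightarrow> nat" where
  "crude_time n a h L = (3 * h * L) ^ n * height a L"

context dynamics
begin

lemma crosses_increasing:
  assumes "proper \<omega>" "s \<le> t" "crosses F a h L s \<omega>"
  shows "crosses F a h L t \<omega>"
  using assms above_surface_le[OF evolution_increasing[OF proper_env_in[OF assms(1)] assms(2)]]
  unfolding crosses_def by blast

lemma step_outside_box:
  assumes "S x = Fin z" "(x, z) \<notin> C"
  shows "step F (env_in C \<omega>) S x = Fin z"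
  using assms by (simp add: step_def env_in_def blocked_site)

lemma confined_evolution:
  assumes fin: "proper \<omega>" and "x \<in> base h L"
  obtains z where "evolution F (env_in (box_C a h L) \<omega>) (floor_surface h L) t x = Fin z"
    "0 \<le> z" "z \<le> int (height a L)"
proof -
  have "\<exists>z. evolution F (env_in (box_C a h L) \<omega>) (floor_surface h L) t x = Fin z \<and>
    0 \<le> z \<and> z \<le> int (height a L)"
  proof (induction t)
    case 0
    then show ?case using assms by (simp add: floor_surface_def)
  next
    case (Suc t)
    then obtain z where z: "evolution F (env_in (box_C a h L) \<omega>) (floor_surface h L) t x = Fin z"
      "0 \<le> z" "z \<le> int (height a L)" by blast
    show ?case
    proof (cases "z = int (height a L)")
      case True
      then show ?thesis using z step_outside_box[of "evolution F (env_in (box_C a h L) \<omega>) (floor_surface h L) t", OF z(1)] by (auto simp: evolution_Suc box_C_def)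
    next
      case False
      then show ?thesis using z step_cases[of "evolution F (env_in (box_C a h L) \<omega>) (floor_surface h L) t" x z
            "env_in (box_C a h L) \<omega>"] proper_env_in[OF fin]
        by (auto simp: evolution_Suc)
    qed
  qed
  then show ?thesis using that by blast
qed

text \<open>
  At a column where a blocking surface \<open>S\<close> is at most as high as the box,
  \<open>S\<close> does not move, so monotonicity keeps the evolution below it; where
  \<open>S\<close> is higher than the box, the evolution stays below because it never leaves the
  box.
\<close>

lemma below_blocking_surface:
  assumes fin: "proper \<omega>" and blocks: "blocks F a h L \<omega> S"
  shows "surface_le (evolution F (env_in (box_C a h L) \<omega>) (floor_surface h L) t) S"
    (is "surface_le (?E t) S")
proof (induction t)
  case 0
  have "above 0 (S x)" if "x \<in> base h L" for x
    using blocks that by (auto simp: blocks_def above_iff_ereal zero_ereal_def)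
  then show ?case by (auto simp: surface_le_def floor_surface_def split: if_splits)
next
  case (Suc t)
  let ?\<eta> = "env_in (box_C a h L) \<omega>"
  have le: "surface_le (?E (Suc t)) (step F ?\<eta> S)"
    using step_mono[OF Suc order_refl proper_env_in[OF fin]] by (simp add: evolution_Suc)
  show ?case unfolding surface_le_def
  proof (intro allI impI)
    fix x z assume z: "?E (Suc t) x = Fin z"
    have x: "x \<in> base h L"
    proof (rule ccontr)
      assume "x \<notin> base h L"
      then have "floor_surface h L x = MInf" by (simp add: floor_surface_def)
      then have "?E (Suc t) x = MInf" by simp
      with z show False by simp
    qed
    show "above z (S x)"
    proof (cases "ereal_of_zbar (S x) \<le> ereal (real (height a L))")
      case True
      then have "step F ?\<eta> S x = S x" using blocks x by (simp add: blocks_def obstructed_at_def)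
      then show ?thesis using le z by (metis surface_le_def)
    next
      case False
      moreover have "z \<le> int (height a L)" using confined_evolution[OF fin x, of a "Suc t"] z by auto
      then have "ereal (of_int z) \<le> ereal (real (height a L))"
        by simp
      ultimately show ?thesis unfolding above_iff_ereal by (meson linear order_trans)
    qed
  qed
qed

text \<open>
  The sum of the heights over the base increases by at least one with every step that changes the
  surface, and it is bounded by the volume of the box.
\<close>

lemma evolution_stabilizes:
  fixes a h L :: nat
  assumes fin: "proper \<omega>"
  defines "E \<equiv> evolution F (env_in (box_C a h L) \<omega>) (floor_surface h L)"
  shows "step F (env_in (box_C a h L) \<omega>) (E (crude_time CARD('n) a h L)) = E (crude_time CARD('n) a h L)"
proof -
  let ?\<eta> = "env_in (box_C a h L) \<omega>" and ?K = "crude_time CARD('n) a h L"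
  let ?B = "base h L :: (int ^ 'n) set"
  define \<Phi> where "\<Phi> t = (\<Sum>x\<in>?B. the_Fin (E t x))" for t
  have conf: "\<exists>z. E t x = Fin z \<and> 0 \<le> z \<and> z \<le> int (height a L)" if "x \<in> ?B" for t x
    using confined_evolution[OF fin that, of a t] unfolding E_def by blast
  have upper: "\<Phi> t \<le> int ?K" for t
  proof -
    have "\<Phi> t \<le> (\<Sum>x\<in>?B. int (height a L))"
      unfolding \<Phi>_def using conf[of _ t] by (intro sum_mono) fastforce
    then show ?thesis by (simp add: card_base crude_time_def)
  qed
  have ESuc: "E (Suc t) = step F ?\<eta> (E t)" for t by (simp add: E_def evolution_Suc)
  have grow: "\<Phi> t + 1 \<le> \<Phi> (Suc t)" if ne: "E (Suc t) \<noteq> E t" for t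
  proof -
    have fs: "E (Suc t) x = E t x \<or> the_Fin (E (Suc t) x) = the_Fin (E t x) + 1" if xB: "x \<in> ?B" for x
    proof -
      obtain z where "E t x = Fin z" using conf[OF xB, of t] by blast
      then show ?thesis using step_cases[of "E t" x z ?\<eta>] proper_env_in[OF fin] by (auto simp: ESuc)
    qed
    obtain x where x: "E (Suc t) x \<noteq> E t x" using ne by blast
    have xB: "x \<in> ?B"
    proof (rule ccontr)
      assume "x \<notin> ?B"
      then have "E s x = MInf" for s by (simp add: E_def floor_surface_def)
      with x show False by simp
    qed
    have "\<Phi> t < \<Phi> (Suc t)" unfolding \<Phi>_def
    proof (rule sum_strict_mono_ex1)
      show "\<forall>x\<in>?B. the_Fin (E t x) \<le> the_Fin (E (Suc t) x)"
      proof
        fix y assume "y \<in> ?B" then show "the_Fin (E t y) \<le> the_Fin (E (Suc t) y)"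
          using fs[of y] by auto
      qed
      show "\<exists>x\<in>?B. the_Fin (E t x) < the_Fin (E (Suc t) x)" using fs[OF xB] x by (intro bexI[OF _ xB]) auto
    qed (rule finite_base)
    then show ?thesis by simp
  qed
  have "\<exists>t\<le>?K. E (Suc t) = E t"
  proof (rule ccontr)
    assume no: "\<not> (\<exists>t\<le>?K. E (Suc t) = E t)"
    have "t \<le> Suc ?K \<longrightarrow> int t \<le> \<Phi> t" for t
    proof (induction t)
      case 0
      have "0 \<le> \<Phi> 0" unfolding \<Phi>_def
      proof (rule sum_nonneg)
        fix y assume "y \<in> ?B" then show "0 \<le> the_Fin (E 0 y)" using conf[of y 0] by auto
      qed
      then show ?case by simp
    next
      case (Suc t) then show ?case using grow[of t] no by auto
    qed
    from this[of "Suc ?K"] upper[of "Suc ?K"] show False by simp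
  qed
  then obtain t where t: "t \<le> ?K" "E (Suc t) = E t" by blast
  have const: "E s = E t" if "t \<le> s" for s
    using that
  proof (induction rule: dec_induct)
    case base
    show ?case ..
  next
    case (step s)
    then show ?case using ESuc[of s] ESuc[of t] t(2) by argo
  qed
  have "E (Suc ?K) = E ?K"
    using const[OF t(1)] const[OF le_SucI[OF t(1)]] by argo
  then show ?thesis unfolding ESuc .
qed

text \<open>
  A blocking surface holds the evolution down forever, at the point where its graph meets the
  central box. Conversely, if the evolution has not crossed in the crude time, then the surface at
  which it froze is itself blocking. This turns the finite size criterion into a bound on the
  probability of not crossing, and replaces a quantification over all surfaces by an event that
  depends measurably on the environment.
\<close>

lemma blocked_iff_not_crosses:
  assumes fin: "proper \<omega>"
  shows "(\<exists>S. blocks F a h L \<omega> S) \<longleftrightarrow> \<not> crosses F a h L (crude_time CARD('n) a h L) \<omega>"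
    (is "_ \<longleftrightarrow> \<not> crosses F a h L ?K \<omega>")
proof
  let ?E = "evolution F (env_in (box_C a h L) \<omega>) (floor_surface h L) ?K"
  assume "\<exists>S. blocks F a h L \<omega> S"
  then obtain S where S: "blocks F a h L \<omega> S" by blast
  then have "graph_of S \<inter> box_B h L \<noteq> {}" unfolding blocks_def by blast
  then obtain x z where xz: "S x = Fin z" "x \<in> middle h L" "z < int L"
    by (auto simp: graph_of_def box_B_def middle_def)
  have "\<not> above (int L) (?E x)"
  proof
    assume "above (int L) (?E x)"
    then have "above (int L) (S x)"
      by (rule above_surface_le[OF below_blocking_surface[OF fin S]])
    with xz show False by simp
  qed
  then show "\<not> crosses F a h L ?K \<omega>" using xz by (auto simp: crosses_def)
next
  let ?E = "evolution F (env_in (box_C a h L) \<omega>) (floor_surface h L) ?K"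
  assume "\<not> crosses F a h L ?K \<omega>"
  then obtain x where x: "x \<in> middle h L" "\<not> above (int L) (?E x)" by (auto simp: crosses_def)
  have "x \<in> base h L" using x(1) middle_subset_base by blast
  then obtain z where z: "?E x = Fin z" "0 \<le> z" by (rule confined_evolution[OF fin])
  have E0: "(x, z) \<in> graph_of ?E \<inter> box_B h L"
    using x z by (simp add: graph_of_def box_B_def middle_def)
  have "ereal_of_zbar (?E y) \<ge> 0" if y: "y \<in> base h L" for y
  proof -
    from y obtain z where "?E y = Fin z" "0 \<le> z" by (rule confined_evolution[OF fin])
    then show ?thesis by simp
  qed
  moreover have "graph_of ?E \<inter> box_B h L \<noteq> {}" using E0 by (rule ex_in_conv[THEN iffD1, OF exI])
  moreover have "step F (env_in (box_C a h L) \<omega>) ?E = ?E"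
    by (rule evolution_stabilizes[OF fin])
  ultimately have "blocks F a h L \<omega> ?E"
    unfolding blocks_def obstructed_at_def by simp
  then show "\<exists>S. blocks F a h L \<omega> S" by blast
qed

end

section \<open>Climbing through levels of boxes\<close>

text \<open>
  The translates of a box are placed on a grid with horizontal mesh \<open>h L\<close>, the width
  of the middle third, and vertical mesh \<open>L\<close>: the middles of the boxes of a level
  then tile the space, and each is raised to the floor of the next level.
\<close>

definition corner :: "nat \<Rightarrow> nat \<Rightarrow> int ^ 'n::finite \<Rightarrow> nat \<Rightarrow> 'n site" where
  "corner h L i j = ((\<chi> k. int (h * L) * i $ k), int (L * j))"

context dynamics
begin

lemma climb_box:
  assumes fin: "proper \<eta>" and env: "env_in (box_C a h L) (shift v \<omega>) \<le> shift v \<eta>"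
    and start: "\<And>x. x \<in> base h L \<Longrightarrow> above (snd v) (S (x + fst v))"
    and crosses: "crosses F a h L T (shift v \<omega>)"
    and x: "x \<in> middle h L"
  shows "above (int L + snd v) (evolution F \<eta> S T (x + fst v))"
proof -
  have "surface_le (floor_surface h L) (translate v S)"
    using start by (auto simp: surface_le_def floor_surface_def split: if_splits)
  then have "surface_le (evolution F (env_in (box_C a h L) (shift v \<omega>)) (floor_surface h L) T)
      (evolution F (shift v \<eta>) (translate v S) T)"
    using env proper_shift[OF fin] by (rule evolution_mono)
  moreover have "above (int L) (evolution F (env_in (box_C a h L) (shift v \<omega>)) (floor_surface h L) T x)"
    using crosses x by (simp add: crosses_def)
  ultimately have "above (int L) (evolution F (shift v \<eta>) (translate v S) T x)"
    by (rule above_surface_le)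
  then show ?thesis by (simp add: evolution_translate)
qed

text \<open>
  A point of the middle of a box of level \<open>j\<close> needs the floor \<open>j L\<close> on
  the whole base of that box, which sticks out by one cell on each side. Thus every level gained
  costs one cell of width on each side of the region.
\<close>

lemma climb_levels:
  fixes m M :: int and \<tau> :: "nat \<Rightarrow> nat"
  assumes fin: "proper \<eta>" and pos: "0 < h" "0 < L"
    and start: "\<And>x. \<forall>k. int (h * L) * m \<le> x $ k \<and> x $ k < int (h * L) * M \<Longrightarrow> above 0 (S x)"
    and env: "\<And>i j. j < J \<Longrightarrow> \<forall>k. m \<le> i $ k \<and> i $ k + 3 \<le> M \<Longrightarrow>
      env_in (box_C a h L) (shift (corner h L i j) \<omega>) \<le> shift (corner h L i j) \<eta>"
    and crosses: "\<And>i j. j < J \<Longrightarrow> \<forall>k. m \<le> i $ k \<and> i $ k + 3 \<le> M \<Longrightarrow>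
      crosses F a h L (\<tau> j) (shift (corner h L i j) \<omega>)"
    and x: "\<forall>k. int (h * L) * (m + int J) \<le> x $ k \<and> x $ k < int (h * L) * (M - int J)"
  shows "above (int (L * J)) (evolution F \<eta> S (\<Sum>j<J. \<tau> j) x)"
  using env crosses x
proof (induction J arbitrary: x)
  case 0
  then show ?case using start by simp
next
  case (Suc J)
  define r where "r = int (h * L)"
  have r: "r > 0" using pos by (simp add: r_def)
  \<comment> \<open>The box whose middle third contains \<open>x\<close>; the base starts one cell to the left of the middle.\<close>
  define i :: "int ^ 'n" where "i = (\<chi> k. x $ k div r - 1)"
  have lo: "m + int J \<le> i $ k" and hi: "i $ k + 3 \<le> M - int J" for k
  proof -
    have "r * (m + int (Suc J)) \<le> x $ k" "x $ k < r * (M - int (Suc J))"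
      using Suc.prems(3) by (auto simp: r_def)
    moreover have "x $ k = r * (x $ k div r) + x $ k mod r" "0 \<le> x $ k mod r" "x $ k mod r < r"
      using r by auto
    ultimately have "r * (m + int (Suc J)) < r * (x $ k div r) + r"
      "r * (x $ k div r) < r * (M - int (Suc J))"
      by linarith+
    then have "r * (m + int (Suc J)) < r * (x $ k div r + 1)"
      "r * (x $ k div r) < r * (M - int (Suc J))"
      by (simp_all only: distrib_left mult_1_right)
    then have "m + int (Suc J) < x $ k div r + 1" "x $ k div r < M - int (Suc J)"
      using r by (simp_all only: mult_less_cancel_left_pos)
    then show "m + int J \<le> i $ k" "i $ k + 3 \<le> M - int J" by (simp_all add: i_def)
  qed
  have range: "m \<le> i $ k" "i $ k + 3 \<le> M" for k using lo[of k] hi[of k] by auto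
  let ?v = "corner h L i J"
  let ?S = "evolution F \<eta> S (\<Sum>j<J. \<tau> j)"
  have start': "above (snd ?v) (?S (y + fst ?v))" if y: "y \<in> base h L" for y
  proof -
    have "r * (m + int J) \<le> (y + fst ?v) $ k \<and> (y + fst ?v) $ k < r * (M - int J)" for k
    proof -
      have "0 \<le> y $ k" "y $ k < 3 * r" using y by (auto simp: base_def r_def mult_ac)
      moreover have "r * (m + int J) \<le> r * i $ k" "r * (i $ k + 3) \<le> r * (M - int J)"
        using lo[of k] hi[of k] r by (simp_all add: mult_le_cancel_left_pos)
      moreover have "(y + fst ?v) $ k = y $ k + r * i $ k" by (simp add: corner_def r_def)
      ultimately show ?thesis by (simp add: algebra_simps)
    qed
    then have "above (int (L * J)) (?S (y + fst ?v))"
      using Suc.prems(1,2) unfolding r_def by (intro Suc.IH) auto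
    then show ?thesis by (simp add: corner_def)
  qed
  have mid: "x - fst ?v \<in> middle h L"
  proof -
    have "r \<le> (x - fst ?v) $ k \<and> (x - fst ?v) $ k < 2 * r" for k
    proof -
      have "x $ k = r * (x $ k div r) + x $ k mod r" by simp
      moreover have "0 \<le> x $ k mod r" "x $ k mod r < r" using r by auto
      moreover have "(x - fst ?v) $ k = x $ k - r * (x $ k div r) + r"
        by (simp add: corner_def i_def r_def algebra_simps)
      ultimately show ?thesis by linarith
    qed
    then show ?thesis by (simp add: middle_def r_def mult_ac)
  qed
  have "above (int L + snd ?v) (evolution F \<eta> ?S (\<tau> J) (x - fst ?v + fst ?v))"
    using fin Suc.prems(1)[of J i] start' Suc.prems(2)[of J i] mid range
    by (intro climb_box) auto
  then show ?case by (simp add: evolution_add corner_def)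
qed

lemma env_in_sub_box:
  assumes "\<And>q. q \<in> A \<Longrightarrow> q + v \<in> B"
  shows "env_in A (shift v \<omega>) \<le> shift v (env_in B \<omega>)"
  using assms by (auto simp: le_fun_def env_in_def shift_def)

text \<open>
  The top level of small boxes starts below \<open>L ^ \<gamma>\<close>, so this is what keeps all
  the small boxes inside the large one.
\<close>

lemma nested_height:
  fixes L :: nat
  assumes "2 \<le> L" "2 \<le> \<gamma>" "1 \<le> a"
  shows "L ^ \<gamma> + height a L \<le> height a (L ^ \<gamma>)"
proof -
  obtain a' g where ag: "a = Suc a'" "\<gamma> = Suc (Suc g)" using assms
    by (metis One_nat_def Suc_le_D add_2_eq_Suc le_add_diff_inverse)
  have e1: "Suc \<gamma> \<le> \<gamma> * (a + 1)" "Suc (a + 1) \<le> \<gamma> * (a + 1)" by (simp_all add: ag algebra_simps)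
  have "2 * L ^ \<gamma> \<le> L ^ Suc \<gamma>" "2 * L ^ (a + 1) \<le> L ^ Suc (a + 1)" using assms by simp_all
  moreover have "L ^ Suc \<gamma> \<le> L ^ (\<gamma> * (a + 1))" "L ^ Suc (a + 1) \<le> L ^ (\<gamma> * (a + 1))"
    using power_increasing[OF e1(1), of L] power_increasing[OF e1(2), of L] assms(1) by linarith+
  moreover have "(L ^ \<gamma>) ^ (a + 1) = L ^ (\<gamma> * (a + 1))" by (simp only: power_mult)
  ultimately show ?thesis unfolding height_def by linarith
qed

lemma sub_box:
  fixes L \<gamma> :: nat
  assumes L: "2 \<le> L" "2 \<le> \<gamma>" "1 \<le> a"
    and i: "\<forall>k. 0 \<le> i $ k \<and> i $ k + 3 \<le> 3 * int (L ^ (\<gamma> - 1))" and j: "j < L ^ (\<gamma> - 1)"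
    and q: "q \<in> box_C a h L"
  shows "q + corner h L i j \<in> box_C a h (L ^ \<gamma>)"
proof -
  obtain x z where [simp]: "q = (x, z)" by (cases q)
  have N: "L ^ \<gamma> = L * L ^ (\<gamma> - 1)" using L by (cases \<gamma>) auto
  let ?N = "L ^ (\<gamma> - 1)"
  have "0 \<le> (x + fst (corner h L i j)) $ k \<and> (x + fst (corner h L i j)) $ k < int (3 * h * L ^ \<gamma>)" for k
  proof -
    have "0 \<le> x $ k" "x $ k < 3 * int (h * L)" using q by (auto simp: box_C_def base_def mult_ac)
    moreover have "0 \<le> int (h * L) * i $ k" "int (h * L) * (i $ k + 3) \<le> int (h * L) * (3 * int ?N)"
      using i by (auto intro!: mult_left_mono mult_nonneg_nonneg)
    moreover have "int (3 * h * L ^ \<gamma>) = int (h * L) * (3 * int ?N)" by (simp add: N)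
    moreover have "int (h * L) * (i $ k + 3) = int (h * L) * i $ k + 3 * int (h * L)"
      by (simp add: distrib_left)
    moreover have "(x + fst (corner h L i j)) $ k = x $ k + int (h * L) * i $ k"
      by (simp add: corner_def)
    ultimately show ?thesis by linarith
  qed
  moreover have "0 \<le> z + int (L * j) \<and> z + int (L * j) < int (height a (L ^ \<gamma>))"
  proof -
    have "L * j \<le> L ^ \<gamma>" using j by (simp add: N)
    then have "L * j + height a L \<le> height a (L ^ \<gamma>)" using nested_height[OF L] by linarith
    moreover have "0 \<le> z" "z < int (height a L)" using q by (auto simp: box_C_def)
    ultimately show ?thesis by linarith
  qed
  ultimately show ?thesis by (simp add: box_C_def base_def corner_def)
qed

text \<open>
  The cells of the base of a large box, which is \<open>3 N\<close> cells wide if \<open>N\<close>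
  is the ratio of the two scales.
\<close>

definition cells :: "nat \<Rightarrow> (int ^ 'n) set" where
  "cells N = {i. \<forall>k. i $ k \<in> {0..<3 * int N}}"

text \<open>
  The large box is crossed by climbing its \<open>N\<close> levels one after the other; losing
  \<open>N\<close> cells on each side of a base of \<open>3 N\<close> cells leaves exactly the
  middle third. A level all of whose boxes cross in time \<open>T\<close> takes time
  \<open>T\<close>, and at each of the others one waits for the crude time \<open>K\<close>. Only
  the number of slow levels matters, not how many slow boxes they contain.
\<close>

lemma crosses_next_scale:
  fixes L \<gamma> :: nat
  assumes fin: "proper \<omega>" and L: "2 \<le> L" "2 \<le> \<gamma>" "1 \<le> a" and h: "0 < h"
  defines "N \<equiv> L ^ (\<gamma> - 1)"
  assumes crude: "\<And>i j. i \<in> cells N \<Longrightarrow> j < N \<Longrightarrow> crosses F a h L K (shift (corner h L i j) \<omega>)"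
    and few: "card {j. j < N \<and> (\<exists>i\<in>cells N. \<not> crosses F a h L T (shift (corner h L i j) \<omega>))} \<le> m"
  shows "crosses F a h (L ^ \<gamma>) (N * T + m * K) \<omega>"
proof -
  let ?J = "{j. j < N \<and> (\<exists>i\<in>cells N. \<not> crosses F a h L T (shift (corner h L i j) \<omega>))}"
  define \<tau> where "\<tau> j = (if j \<in> ?J then K else T)" for j
  have LN: "L ^ \<gamma> = L * N" using L unfolding N_def by (cases \<gamma>) auto
  have fin': "proper (env_in (box_C a h (L ^ \<gamma>)) \<omega>)" using fin by (rule proper_env_in)
  have cellsI: "i \<in> cells N" if "\<forall>k. 0 \<le> i $ k \<and> i $ k + 3 \<le> 3 * int N" for i :: "int ^ 'n"
  proof -
    have "i $ k \<in> {0..<3 * int N}" for k using that[rule_format, of k] by simp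
    then show ?thesis by (simp add: cells_def)
  qed
  have "(\<Sum>j<N. \<tau> j) = card ?J * K + card ({..<N} - ?J) * T"
  proof -
    have "(\<Sum>j<N. \<tau> j) = (\<Sum>j\<in>?J. \<tau> j) + (\<Sum>j\<in>{..<N} - ?J. \<tau> j)"
      by (subst sum.subset_diff[of ?J]) auto
    then show ?thesis by (simp add: \<tau>_def)
  qed
  also have "\<dots> \<le> m * K + N * T"
  proof (rule add_mono)
    show "card ?J * K \<le> m * K" using few by (rule mult_right_mono) simp
    have "card ({..<N} - ?J) \<le> card {..<N}" by (rule card_mono) auto
    then show "card ({..<N} - ?J) * T \<le> N * T" by (intro mult_right_mono) simp_all
  qed
  finally have time: "(\<Sum>j<N. \<tau> j) \<le> N * T + m * K" by simp
  have "crosses F a h (L ^ \<gamma>) (\<Sum>j<N. \<tau> j) \<omega>"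
    unfolding crosses_def
  proof
    fix x :: "int ^ 'n" assume x: "x \<in> middle h (L ^ \<gamma>)"
    have "above (int (L * N))
        (evolution F (env_in (box_C a h (L ^ \<gamma>)) \<omega>) (floor_surface h (L ^ \<gamma>)) (\<Sum>j<N. \<tau> j) x)"
    proof (rule climb_levels[where m = 0 and M = "3 * int N" and \<omega> = \<omega> and h = h and a = a])
      fix y :: "int ^ 'n"
      assume "\<forall>k. int (h * L) * 0 \<le> y $ k \<and> y $ k < int (h * L) * (3 * int N)"
      then have "y \<in> base h (L ^ \<gamma>)" by (simp add: base_def LN mult_ac)
      then show "above 0 (floor_surface h (L ^ \<gamma>) y)" by (simp add: floor_surface_def)
    next
      fix i :: "int ^ 'n" and j
      assume "j < N" "\<forall>k. 0 \<le> i $ k \<and> i $ k + 3 \<le> 3 * int N"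
      then show "env_in (box_C a h L) (shift (corner h L i j) \<omega>)
          \<le> shift (corner h L i j) (env_in (box_C a h (L ^ \<gamma>)) \<omega>)"
        using sub_box[OF L] unfolding N_def by (intro env_in_sub_box) auto
    next
      fix i :: "int ^ 'n" and j
      assume "j < N" "\<forall>k. 0 \<le> i $ k \<and> i $ k + 3 \<le> 3 * int N"
      then show "crosses F a h L (\<tau> j) (shift (corner h L i j) \<omega>)"
        using crude cellsI by (auto simp: \<tau>_def)
    next
      show "\<forall>k. int (h * L) * (0 + int N) \<le> x $ k \<and> x $ k < int (h * L) * (3 * int N - int N)"
        using x by (auto simp: middle_def LN algebra_simps)
    qed (use fin' h L in auto)
    then show "above (int (L ^ \<gamma>))
        (evolution F (env_in (box_C a h (L ^ \<gamma>)) \<omega>) (floor_surface h (L ^ \<gamma>)) (\<Sum>j<N. \<tau> j) x)"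
      by (simp add: LN)
  qed
  then show ?thesis using crosses_increasing[OF fin time] by blast
qed

end

lemma spaced_points:
  fixes J :: "nat set"
  assumes "finite J" "D * g \<le> card J" "0 < g"
  shows "\<exists>f. (\<forall>s<D. f s \<in> J) \<and> (\<forall>s<D. \<forall>t<D. s < t \<longrightarrow> f s + g \<le> f t)"
  using assms
proof (induction D arbitrary: J)
  case 0
  then show ?case by auto
next
  case (Suc D)
  have J: "J \<noteq> {}" using Suc.prems by auto
  define m where "m = Min J"
  \<comment> \<open>Greedy choice: keep the least element and discard the window of length \<open>g\<close> that it starts.\<close>
  define J' where "J' = J - {m..<m + g}"
  have "card J - card {m..<m + g} \<le> card J'"
    unfolding J'_def by (rule diff_card_le_card_Diff) simp
  then have "D * g \<le> card J'" using Suc.prems by simp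
  moreover have "finite J'" using Suc.prems by (simp add: J'_def)
  ultimately obtain f where f: "\<forall>s<D. f s \<in> J'" "\<forall>s<D. \<forall>t<D. s < t \<longrightarrow> f s + g \<le> f t"
    using Suc.IH Suc.prems(3) by blast
  have far: "m + g \<le> j" if "j \<in> J'" for j
    using that Suc.prems(1) Min_le[of J j] by (auto simp: J'_def m_def)
  define f' where "f' s = (case s of 0 \<Rightarrow> m | Suc s \<Rightarrow> f s)" for s
  have "\<forall>s<Suc D. f' s \<in> J"
    using f(1) J Suc.prems(1) by (auto simp: f'_def J'_def m_def split: nat.split)
  moreover have "\<forall>s<Suc D. \<forall>t<Suc D. s < t \<longrightarrow> f' s + g \<le> f' t"
    using f far by (auto simp: f'_def split: nat.split)
  ultimately show ?case by blast
qed

section \<open>Measurability\<close>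

lemma space_Rbar [simp]: "space Rbar = {..<\<infinity>}"
  by (simp add: Rbar_def space_restrict_space)

lemma space_Omega: "space Omega = {\<omega>. proper \<omega>}"
  by (auto simp: Omega_def space_PiM PiE_def proper_def)

text \<open>
  A down-closed set is one of the two rays that end at its supremum.
\<close>

lemma down_closed_borel:
  fixes A :: "ereal set"
  assumes down: "\<And>x y. x \<in> A \<Longrightarrow> y \<le> x \<Longrightarrow> y \<in> A"
  shows "A \<in> sets borel"
proof -
  have lt: "{..<Sup A} \<subseteq> A"
  proof
    fix y assume "y \<in> {..<Sup A}"
    then obtain x where "x \<in> A" "y < x" by (auto simp: less_Sup_iff)
    then show "y \<in> A" using down[of x y] by auto
  qed
  have le: "A \<subseteq> {..Sup A}" by (auto intro: Sup_upper)
  have "A = {..<Sup A} \<or> A = {..Sup A}"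
  proof (cases "Sup A \<in> A")
    case True
    have "{..Sup A} \<subseteq> A" using down[OF True] by auto
    with le show ?thesis by auto
  next
    case False
    have "A \<subseteq> {..<Sup A}"
    proof
      fix y assume "y \<in> A"
      moreover from this have "y \<le> Sup A" by (rule Sup_upper)
      ultimately show "y \<in> {..<Sup A}" using False by (cases "y = Sup A") auto
    qed
    with lt show ?thesis by auto
  qed
  then show ?thesis by (metis borel_closed borel_open closed_atMost open_lessThan)
qed

text \<open>
  Measurability is needed twice, under the law of the whole environment and, for the mixing
  condition, for functions of the environment in a finite cube; hence the environment is an
  arbitrary random element here.
\<close>

definition random_environment :: "'b measure \<Rightarrow> ('b \<Rightarrow> 'n::finite environment) \<Rightarrow> bool" where
  "random_environment M \<eta> \<longleftrightarrow> (\<forall>p. (\<lambda>m. \<eta> m p) \<in> measurable M Rbar)"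

lemma random_environmentD: "random_environment M \<eta> \<Longrightarrow> (\<lambda>m. \<eta> m p) \<in> measurable M Rbar"
  unfolding random_environment_def by blast

lemma random_environment_env_in:
  assumes "\<And>p. p \<in> C \<Longrightarrow> (\<lambda>m. \<eta> m p) \<in> measurable M Rbar"
  shows "random_environment M (\<lambda>m. env_in C (\<eta> m))"
  unfolding random_environment_def
proof
  fix p
  show "(\<lambda>m. env_in C (\<eta> m) p) \<in> measurable M Rbar"
    using assms[of p] by (cases "p \<in> C") (simp_all add: env_in_def)
qed

lemma random_environment_Omega: "random_environment Omega (\<lambda>\<omega>. \<omega>)"
  unfolding random_environment_def Omega_def by (auto intro: measurable_component_singleton)

lemma random_environment_shift:
  "random_environment M \<eta> \<Longrightarrow> random_environment M (\<lambda>m. shift v (\<eta> m))"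
  unfolding random_environment_def shift_def by blast

lemma measurable_shift: "shift v \<in> measurable Omega Omega"
proof -
  have "shift v \<in> measurable Omega (\<Pi>\<^sub>M p\<in>UNIV. Rbar)"
  proof (rule measurable_PiM_single')
    fix p :: "'a site"
    show "(\<lambda>\<omega>. shift v \<omega> p) \<in> measurable Omega Rbar"
      by (rule random_environmentD[OF random_environment_shift[OF random_environment_Omega]])
  next
    show "shift v \<in> space Omega \<rightarrow> (\<Pi>\<^sub>E p\<in>UNIV. space Rbar)"
      using proper_shift[of _ v] by (auto simp: space_Omega dest: properD)
  qed
  then show ?thesis by (simp add: Omega_def)
qed

context dynamics
begin

lemma measurable_F: "F u \<in> measurable Rbar (count_space UNIV)"
proof -
  have "{r. r < \<infinity> \<and> F u r = 0} \<in> sets borel"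
  proof (rule down_closed_borel)
    fix x y :: ereal
    assume "x \<in> {r. r < \<infinity> \<and> F u r = 0}" "y \<le> x"
    then show "y \<in> {r. r < \<infinity> \<and> F u r = 0}" using F_mono[of u u y x] by auto
  qed
  then have "{r. r < \<infinity> \<and> F u r = 0} \<in> sets Rbar"
    by (auto simp: Rbar_def sets_restrict_space image_iff intro!: bexI[of _ "{r. r < \<infinity> \<and> F u r = 0}"])
  then have zero: "{r \<in> space Rbar. F u r = 0} \<in> sets Rbar" by (simp add: lessThan_def)
  then have one: "{r \<in> space Rbar. F u r \<noteq> 0} \<in> sets Rbar"
    by (rule sets.sets_Collect_neg)
  show ?thesis
  proof (rule measurable_count_space_eq2_countable[THEN iffD2], intro conjI ballI)
    fix n :: nat
    have "F u -` {n} \<inter> space Rbar =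
        (if n = 0 then {r \<in> space Rbar. F u r = 0} else if n = 1 then {r \<in> space Rbar. F u r \<noteq> 0} else {})"
    proof -
      have "F u r = 0 \<or> F u r = 1" if "r \<in> space Rbar" for r
        using F_cases[of r u] that by simp
      then show ?thesis by force
    qed
    then show "F u -` {n} \<inter> space Rbar \<in> sets Rbar" using zero one by auto
  qed auto
qed

text \<open>
  The height at a site after one more step is a function of the heights of that site and of its
  finitely many neighbours, which take countably many values, and of one environment variable for
  each possible height. Whether a height is \<open>-\<infinity>\<close> does not depend on the
  environment, which leaves only integer heights to quantify over.
\<close>

lemma pred_evolution:
  assumes env: "random_environment M \<eta>"
  shows "Measurable.pred M (\<lambda>m. evolution F (\<eta> m) S t x = Fin z)"
proof (induction t arbitrary: x z)
  case 0
  then show ?case by simp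
next
  case (Suc t)
  have [measurable]: "Measurable.pred M (\<lambda>m. z = z1 + int (F v (\<eta> m (x, z1))))" for z1 v
  proof -
    have "(\<lambda>m. F v (\<eta> m (x, z1))) \<in> measurable M (count_space UNIV)"
      by (rule measurable_compose[OF random_environmentD[OF env] measurable_F])
    then show ?thesis by measurable
  qed
  note [measurable] = Suc
  show ?case
  proof (cases "\<exists>e. S (x + dir e) = MInf")
    case True
    then have "evolution F (\<eta> m) S (Suc t) x = Fin z \<longleftrightarrow> evolution F (\<eta> m) S t x = Fin z" for m
    proof -
      have "\<exists>e. evolution F (\<eta> m) S t (x + dir e) = MInf" using True by simp
      then show ?thesis
        by (cases "evolution F (\<eta> m) S t x") (simp_all add: evolution_Suc step_def del: evolution_MInf_iff)
    qed
    then show ?thesis using Suc by simp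
  next
    case False
    have "evolution F (\<eta> m) S (Suc t) x = Fin z \<longleftrightarrow>
        (\<exists>z1. evolution F (\<eta> m) S t x = Fin z1 \<and>
          (\<exists>u. (\<forall>e. evolution F (\<eta> m) S t (x + dir e) = Fin (u e)) \<and>
               z = z1 + int (F (\<lambda>e. u e - z1) (\<eta> m (x, z1)))))" (is "?l \<longleftrightarrow> ?r") for m
    proof -
      let ?E = "evolution F (\<eta> m) S t"
      have "?E (x + dir e) \<noteq> MInf" for e unfolding evolution_MInf_iff using False by blast
      then have "\<forall>e. \<exists>u. ?E (x + dir e) = Fin u" by (metis zbar.exhaust)
      then obtain u where u: "\<And>e. ?E (x + dir e) = Fin (u e)" by metis
      have uniq: "(\<forall>e. u e = u' e) \<longleftrightarrow> u' = u" for u' by (auto simp: fun_eq_iff)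
      show ?thesis
        by (cases "?E x")
          (auto simp: evolution_Suc step_def u uniq simp del: evolution_MInf_iff split_paired_All)
    qed
    then show ?thesis by simp
  qed
qed

lemma pred_crosses:
  assumes "random_environment M (\<lambda>m. env_in (box_C a h L) (\<eta> m))"
  shows "Measurable.pred M (\<lambda>m. crosses F a h L T (\<eta> m))"
proof -
  note [measurable] = pred_evolution[OF assms]
  have fin: "finite (middle h L :: (int ^ 'n) set)"
    using finite_subset[OF middle_subset_base finite_base] .
  show ?thesis unfolding crosses_def above_def
    by (intro pred_intros_finite fin pred_intros_countable pred_intros_logic) measurable
qed

end

section \<open>The probability of a slow box\<close>

locale random_dynamics = dynamics F for F :: "'n::finite update" +
  fixes P :: "'n environment measure"
  assumes law: "translation_invariant_law P"
begin

sublocale prob_space P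
  using law by (simp add: translation_invariant_law_def)

lemma sets_P: "sets P = sets Omega"
  using law by (simp add: translation_invariant_law_def)

lemma space_P: "space P = {\<omega>. proper \<omega>}"
  using sets_eq_imp_space_eq[OF sets_P] by (simp add: space_Omega)

definition bad :: "nat \<Rightarrow> nat \<Rightarrow> nat \<Rightarrow> nat \<Rightarrow> 'n site \<Rightarrow> 'n environment set" where
  "bad a h L T v = {\<omega> \<in> space P. \<not> crosses F a h L T (shift v \<omega>)}"

lemma bad_sets [measurable]: "bad a h L T v \<in> events"
proof -
  have "random_environment Omega (\<lambda>\<omega>. env_in (box_C a h L) (shift v \<omega>))"
    by (intro random_environment_env_in random_environmentD random_environment_shift
        random_environment_Omega)
  then have "random_environment P (\<lambda>\<omega>. env_in (box_C a h L) (shift v \<omega>))"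
    unfolding random_environment_def using measurable_cong_sets[OF sets_P refl] by blast
  note [measurable] = pred_crosses[OF this]
  show ?thesis unfolding bad_def by measurable
qed

lemma prob_bad: "prob (bad a h L T v) = prob (bad a h L T 0)"
proof -
  have meas: "shift v \<in> measurable P P"
    using measurable_shift measurable_cong_sets[OF sets_P sets_P] by blast
  have "prob (bad a h L T 0) = measure (distr P P (shift v)) (bad a h L T 0)"
    using law unfolding translation_invariant_law_def by metis
  also have "\<dots> = prob (shift v -` bad a h L T 0 \<inter> space P)"
    by (rule measure_distr[OF meas bad_sets])
  also have "shift v -` bad a h L T 0 \<inter> space P = bad a h L T v"
    by (auto simp: bad_def space_P proper_shift) (simp_all add: shift_def)
  finally show ?thesis ..
qed

lemma prob_crude_bad:
  assumes "FS F a P h \<rho> c2" "c2 \<le> real L"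
  shows "prob (bad a h L (crude_time CARD('n) a h L) 0) \<le> real L powr (- \<rho>)"
proof -
  have "bad a h L (crude_time CARD('n) a h L) 0 = {\<omega> \<in> space P. \<exists>S. blocks F a h L \<omega> S}"
  proof -
    have [simp]: "shift 0 \<omega> = \<omega>" for \<omega> :: "'n environment" by (simp add: shift_def)
    show ?thesis unfolding bad_def space_P using blocked_iff_not_crosses[where a = a and h = h and L = L]
      by simp blast
  qed
  then show ?thesis using assms by (simp add: FS_def)
qed

lemma prod_of_bool:
  "(\<Prod>s<(D::nat). of_bool (Q s) :: real) = of_bool (\<forall>s<D. Q s)"
  by (induction D) (auto simp: less_Suc_eq)

text \<open>
  Boxes at least four box heights apart vertically sit in cubes of side three box heights with
  vertical gaps of at least one box height, which is the geometry of the mixing condition at scale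
  \<open>L ^ (a + 1)\<close>. This makes the mixing error \<open>L ^ (- \<alpha> (a + 1))\<close>.
\<close>

lemma prob_all_bad:
  assumes mix: "Mix P D \<alpha> c1" and M: "c1 \<le> real (height a L)" "h * L \<le> height a L"
    and far: "\<And>s t. s < D \<Longrightarrow> t < D \<Longrightarrow> s < t \<Longrightarrow> snd (v s) + 4 * int (height a L) \<le> snd (v t)"
  shows "prob {\<omega> \<in> space P. \<forall>s<D. \<omega> \<in> bad a h L T (v s)}
    \<le> prob (bad a h L T 0) ^ D + real (height a L) powr (- \<alpha>)"
proof -
  let ?M = "height a L"
  define C where "C s = cube (v s) (3 * ?M)" for s
  define f :: "nat \<Rightarrow> 'n environment \<Rightarrow> real"
    where "f s \<eta> = of_bool (\<not> crosses F a h L T (shift (v s) \<eta>))" for s \<eta>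
  have sub: "p + v s \<in> C s" if "p \<in> box_C a h L" for p s
  proof -
    have "int (3 * h * L) \<le> int (3 * ?M)" using M(2) by (simp del: of_nat_mult)
    moreover have "\<forall>k. 0 \<le> fst p $ k \<and> fst p $ k < int (3 * h * L)" "0 \<le> snd p" "snd p < int ?M"
      using that by (auto simp: box_C_def base_def)
    ultimately show ?thesis unfolding C_def cube_def
      by (fastforce simp del: of_nat_mult intro: order.strict_trans2)
  qed
  have restricted: "f s (restrict \<omega> (C s)) = f s \<omega>" for s \<omega>
    unfolding f_def using sub[of _ s]
    by (subst crosses_cong[of a h L _ "shift (v s) \<omega>"]) (auto simp: shift_def)
  have dist: "sup_dist p q \<ge> int ?M" if "s < D" "t < D" "s \<noteq> t" "p \<in> C s" "q \<in> C t" for s t p q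
  proof -
    have "\<bar>snd p - snd q\<bar> \<ge> int ?M"
      using far[of s t] far[of t s] that by (cases "s < t") (auto simp: C_def cube_def)
    then show ?thesis by (simp add: sup_dist_def)
  qed
  have meas: "f s \<in> borel_measurable (\<Pi>\<^sub>M p\<in>C s. Rbar)" for s
  proof -
    have "random_environment (\<Pi>\<^sub>M p\<in>C s. Rbar) (\<lambda>\<eta>. env_in (box_C a h L) (shift (v s) \<eta>))"
    proof (rule random_environment_env_in)
      fix p :: "'n site" assume "p \<in> box_C a h L"
      then have "(\<lambda>\<eta>. \<eta> (p + v s)) \<in> measurable (\<Pi>\<^sub>M p\<in>C s. Rbar) Rbar"
        using sub by (intro measurable_component_singleton) auto
      then show "(\<lambda>\<eta>. shift (v s) \<eta> p) \<in> measurable (\<Pi>\<^sub>M p\<in>C s. Rbar) Rbar"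
        by (simp add: shift_def)
    qed
    note [measurable] = pred_crosses[OF this]
    show ?thesis unfolding f_def by measurable
  qed
  have "(\<integral>\<omega>. (\<Prod>s<D. f s (restrict \<omega> (C s))) \<partial>P)
      \<le> (\<Prod>s<D. \<integral>\<omega>. f s (restrict \<omega> (C s)) \<partial>P) + real ?M powr (- \<alpha>)"
  proof (rule mix[unfolded Mix_def, rule_format])
    show "c1 \<le> real ?M" by (rule M(1))
    show "\<exists>p. C s = cube p (3 * ?M)" for s unfolding C_def by blast
    show "f s \<in> borel_measurable (\<Pi>\<^sub>M p\<in>C s. Rbar) \<and>
        (\<forall>\<eta>\<in>space (\<Pi>\<^sub>M p\<in>C s. Rbar). 0 \<le> f s \<eta> \<and> f s \<eta> \<le> 1)" for s
      using meas by (simp add: f_def)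
  qed (use dist in auto)
  moreover have "(\<Prod>s<D. f s (restrict \<omega> (C s))) = indicat_real {\<omega> \<in> space P. \<forall>s<D. \<omega> \<in> bad a h L T (v s)} \<omega>"
    if "\<omega> \<in> space P" for \<omega>
    unfolding restricted unfolding f_def prod_of_bool using that by (auto simp: bad_def indicator_def)
  then have "(\<integral>\<omega>. (\<Prod>s<D. f s (restrict \<omega> (C s))) \<partial>P)
      = (\<integral>\<omega>. indicat_real {\<omega> \<in> space P. \<forall>s<D. \<omega> \<in> bad a h L T (v s)} \<omega> \<partial>P)"
    by (intro Bochner_Integration.integral_cong) auto
  moreover have "\<dots> = prob {\<omega> \<in> space P. \<forall>s<D. \<omega> \<in> bad a h L T (v s)}"
    by simp
  moreover have "(\<integral>\<omega>. f s (restrict \<omega> (C s)) \<partial>P) = prob (bad a h L T 0)" for s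
  proof -
    have "(\<integral>\<omega>. f s (restrict \<omega> (C s)) \<partial>P) = (\<integral>\<omega>. indicat_real (bad a h L T (v s)) \<omega> \<partial>P)"
      unfolding restricted by (intro Bochner_Integration.integral_cong) (auto simp: f_def bad_def indicator_def)
    also have "\<dots> = prob (bad a h L T (v s))" by simp
    finally show ?thesis using prob_bad by simp
  qed
  ultimately show ?thesis by simp
qed

lemma cells_card: "finite (cells N :: (int ^ 'n) set)" "card (cells N :: (int ^ 'n) set) = (3 * N) ^ CARD('n)"
  unfolding cells_def
  by (rule finite_int_box, simp)
    (subst finite_int_box(2), simp_all add: nat_mult_distrib)

text \<open>
  If the large box is not crossed, then either some small box is not crossed in the crude time, or
  there are so many slow levels that \<open>D\<close> of them are \<open>4 L ^ a\<close> levels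
  apart, that is, at vertical distance at least four box heights. The factor \<open>B\<close> is
  the number of small boxes, and there are at most \<open>B ^ D\<close> choices of one slow box in
  each of \<open>D\<close> levels.
\<close>

lemma prob_bad_next_scale:
  fixes \<gamma> L D T a h :: nat
  assumes L: "2 \<le> L" "2 \<le> \<gamma>" "1 \<le> a" and h: "0 < h" "h \<le> L" and mix: "Mix P D \<alpha> c1" "c1 \<le> real L"
  defines "N \<equiv> L ^ (\<gamma> - 1)" and "K \<equiv> crude_time CARD('n) a h L"
  defines "B \<equiv> 3 ^ CARD('n) * real N ^ (CARD('n) + 1)"
  shows "prob (bad a h (L ^ \<gamma>) (N * T + D * (4 * L ^ a) * K) 0)
    \<le> B * prob (bad a h L K 0) + B ^ D * (prob (bad a h L T 0) ^ D + real (height a L) powr (- \<alpha>))"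
proof -
  let ?I = "(cells N :: (int ^ 'n) set) \<times> {..<N}"
  let ?c = "\<lambda>(i, j). corner h L i j"
  let ?g = "4 * L ^ a"
  define G where "G = {f \<in> {..<D} \<rightarrow>\<^sub>E ?I. \<forall>s<D. \<forall>t<D. s < t \<longrightarrow> snd (f s) + ?g \<le> snd (f t)}"
  have finI: "finite ?I" using cells_card(1) by simp
  have cardI: "real (card ?I) = B"
    by (simp add: card_cartesian_product cells_card B_def power_mult_distrib)
  have finG: "finite G" unfolding G_def using finI by (intro finite_subset[OF _ finite_PiE[of "{..<D}"]]) auto
  have "card G \<le> card ({..<D} \<rightarrow>\<^sub>E ?I)"
    unfolding G_def using finI by (intro card_mono finite_PiE) auto
  then have "card G \<le> card ?I ^ D" by (simp add: card_PiE)
  then have "real (card G) \<le> real (card ?I ^ D)" by (simp only: of_nat_le_iff)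
  then have cardG: "real (card G) \<le> B ^ D" using cardI by simp
  define U where "U = (\<Union>p\<in>?I. bad a h L K (?c p))"
  define W where "W = (\<Union>f\<in>G. {\<omega> \<in> space P. \<forall>s<D. \<omega> \<in> bad a h L T (?c (f s))})"
  have ev: "{\<omega> \<in> space P. \<forall>s<D. \<omega> \<in> bad a h L T (v s)} \<in> events" for v :: "nat \<Rightarrow> 'n site"
    by measurable
  have bad_U: "bad a h L K (corner h L i j) \<subseteq> U" if "i \<in> cells N" "j < N" for i j
    unfolding U_def using that by (intro SUP_upper2[of "(i, j)"]) simp_all
  have U: "U \<in> events" unfolding U_def using finI by (intro sets.finite_UN) auto
  have W: "W \<in> events" unfolding W_def using finG ev by (intro sets.finite_UN) blast+
  have heightL: "L \<le> height a L" "h * L \<le> height a L"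
  proof -
    have "L ^ 2 \<le> L ^ (a + 1)" using L by (intro power_increasing) auto
    moreover have "h * L \<le> L * L" "1 * L \<le> L * L" using h L by (auto intro!: mult_right_mono)
    ultimately show "L \<le> height a L" "h * L \<le> height a L"
      unfolding height_def power2_eq_square by linarith+
  qed
  have "bad a h (L ^ \<gamma>) (N * T + D * (4 * L ^ a) * K) 0 \<subseteq> U \<union> W"
  proof
    fix \<omega> assume \<omega>: "\<omega> \<in> bad a h (L ^ \<gamma>) (N * T + D * (4 * L ^ a) * K) 0"
    then have prp: "proper \<omega>" and nc: "\<not> crosses F a h (L ^ \<gamma>) (N * T + D * (4 * L ^ a) * K) \<omega>"
      by (auto simp: bad_def space_P shift_def)
    let ?J = "{j. j < N \<and> (\<exists>i\<in>cells N. \<not> crosses F a h L T (shift (corner h L i j) \<omega>))}"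
    show "\<omega> \<in> U \<union> W"
    proof (rule ccontr)
      assume out: "\<omega> \<notin> U \<union> W"
      have crude: "crosses F a h L K (shift (corner h L i j) \<omega>)" if "i \<in> cells N" "j < N" for i j
      proof (rule ccontr)
        assume "\<not> crosses F a h L K (shift (corner h L i j) \<omega>)"
        then have "\<omega> \<in> bad a h L K (corner h L i j)" using prp by (simp add: bad_def space_P)
        then show False using bad_U[OF that] out by blast
      qed
      have "card ?J \<le> D * ?g"
      proof (rule ccontr)
        assume "\<not> card ?J \<le> D * ?g"
        then obtain f where f: "\<forall>s<D. f s \<in> ?J" "\<forall>s<D. \<forall>t<D. s < t \<longrightarrow> f s + ?g \<le> f t"
          using spaced_points[of ?J D ?g] L by auto
        then have "\<forall>s. \<exists>i. s < D \<longrightarrow> i \<in> cells N \<and> \<not> crosses F a h L T (shift (corner h L i (f s)) \<omega>)"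
          by auto
        then obtain i where i: "\<And>s. s < D \<Longrightarrow> i s \<in> cells N"
          "\<And>s. s < D \<Longrightarrow> \<not> crosses F a h L T (shift (corner h L (i s) (f s)) \<omega>)" by metis
        \<comment> \<open>One slow box from each of the \<open>D\<close> spaced levels.\<close>
        define e where "e = restrict (\<lambda>s. (i s, f s)) {..<D}"
        have "e \<in> G" using f i(1) by (auto simp: G_def e_def)
        moreover have "\<omega> \<in> {\<omega> \<in> space P. \<forall>s<D. \<omega> \<in> bad a h L T (?c (e s))}"
          using i(2) prp by (auto simp: e_def bad_def space_P)
        ultimately have "\<omega> \<in> W" unfolding W_def by (intro UN_I[of e])
        then show False using out by simp
      qed
      then show False
        using crosses_next_scale[OF prp L h(1) crude[unfolded N_def], of T "D * ?g"] nc
        by (simp add: N_def)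
    qed
  qed
  then have "prob (bad a h (L ^ \<gamma>) (N * T + D * (4 * L ^ a) * K) 0) \<le> prob (U \<union> W)"
    by (rule finite_measure_mono[OF _ sets.Un[OF U W]])
  also have "\<dots> \<le> prob U + prob W"
    by (rule measure_Un_le[OF U W])
  also have "prob U \<le> (\<Sum>p\<in>?I. prob (bad a h L K (?c p)))"
    unfolding U_def by (rule finite_measure_subadditive_finite[OF finI]) auto
  also have "\<dots> = (\<Sum>p\<in>?I. prob (bad a h L K 0))"
    by (intro sum.cong refl prob_bad)
  also have "\<dots> = B * prob (bad a h L K 0)"
    using cardI by (simp del: card_cartesian_product)
  also have "prob W \<le> (\<Sum>f\<in>G. prob {\<omega> \<in> space P. \<forall>s<D. \<omega> \<in> bad a h L T (?c (f s))})"
    unfolding W_def by (rule finite_measure_subadditive_finite[OF finG image_subsetI[OF ev]])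
  also have "\<dots> \<le> (\<Sum>f\<in>G. prob (bad a h L T 0) ^ D + real (height a L) powr (- \<alpha>))"
  proof (rule sum_mono)
    fix f assume f: "f \<in> G"
    show "prob {\<omega> \<in> space P. \<forall>s<D. \<omega> \<in> bad a h L T (?c (f s))}
        \<le> prob (bad a h L T 0) ^ D + real (height a L) powr (- \<alpha>)"
    proof (rule prob_all_bad[OF mix(1) _ heightL(2)])
      show "c1 \<le> real (height a L)" using mix(2) heightL(1) by linarith
      fix s t assume st: "s < D" "t < D" "s < t"
      then have "snd (f s) + ?g \<le> snd (f t)" using f by (auto simp: G_def)
      then have "L * (snd (f s) + ?g) \<le> L * snd (f t)" by (rule mult_left_mono) simp
      then have "L * snd (f s) + 4 * height a L \<le> L * snd (f t)"
        by (simp add: height_def algebra_simps)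
      then have "int (L * snd (f s)) + 4 * int (height a L) \<le> int (L * snd (f t))" by linarith
      then show "snd (?c (f s)) + 4 * int (height a L) \<le> snd (?c (f t))"
        by (cases "f s"; cases "f t") (simp add: corner_def)
    qed
  qed
  also have "\<dots> = real (card G) * (prob (bad a h L T 0) ^ D + real (height a L) powr (- \<alpha>))" by simp
  also have "\<dots> \<le> B ^ D * (prob (bad a h L T 0) ^ D + real (height a L) powr (- \<alpha>))"
    using cardG by (intro mult_right_mono) auto
  finally show ?thesis by simp
qed

end

section \<open>Scales, times and exponents\<close>

text \<open>
  The scales of the renormalisation: each is the \<open>\<gamma>\<close>-th power of the preceding
  one.
\<close>

definition length_scale :: "nat \<Rightarrow> nat \<Rightarrow> nat \<Rightarrow> nat" where
  "length_scale \<gamma> L0 k = L0 ^ (\<gamma> ^ k)"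

lemma length_scale_0 [simp]: "length_scale \<gamma> L0 0 = L0"
  by (simp add: length_scale_def)

lemma length_scale_Suc: "length_scale \<gamma> L0 (Suc k) = length_scale \<gamma> L0 k ^ \<gamma>"
  by (simp add: length_scale_def power_mult[symmetric] mult.commute)

lemma length_scale_ge:
  assumes "2 \<le> L0" "2 \<le> \<gamma>"
  shows "L0 \<le> length_scale \<gamma> L0 k" "2 ^ (k + 1) \<le> length_scale \<gamma> L0 k"
proof -
  have "k + 1 \<le> \<gamma> ^ k"
  proof -
    have "k + 1 \<le> 2 ^ k" by (induction k) auto
    also have "\<dots> \<le> \<gamma> ^ k" using assms by (intro power_mono) auto
    finally show ?thesis .
  qed
  then have "L0 ^ (k + 1) \<le> length_scale \<gamma> L0 k"
    unfolding length_scale_def using assms by (intro power_increasing) auto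
  moreover have "L0 ^ 1 \<le> L0 ^ (k + 1)" using assms by (intro power_increasing) auto
  moreover have "2 ^ (k + 1) \<le> L0 ^ (k + 1)" using assms by (intro power_mono) auto
  ultimately show "L0 \<le> length_scale \<gamma> L0 k" "2 ^ (k + 1) \<le> length_scale \<gamma> L0 k"
    unfolding power_one_right by - linarith+
qed

text \<open>
  The time within which a box of the scale \<open>k\<close> is crossed unless it counts as slow,
  where \<open>4 D L ^ a\<close> slow levels of the preceding scale are tolerated.
\<close>

fun crossing_time :: "nat \<Rightarrow> nat \<Rightarrow> nat \<Rightarrow> nat \<Rightarrow> nat \<Rightarrow> nat \<Rightarrow> nat \<Rightarrow> nat" where
  "crossing_time n a h D \<gamma> L0 0 = crude_time n a h L0"
| "crossing_time n a h D \<gamma> L0 (Suc k) =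
     length_scale \<gamma> L0 k ^ (\<gamma> - 1) * crossing_time n a h D \<gamma> L0 k
     + D * (4 * length_scale \<gamma> L0 k ^ a) * crude_time n a h (length_scale \<gamma> L0 k)"

text \<open>
  The first term bounds the inverse speed of the crude crossing at the initial scale, uniformly in
  \<open>a\<close> as \<open>a < \<gamma>\<close>; the second one bounds the delays of all scales
  together. Keeping \<open>a\<close> out of this bound is what makes the final speed independent
  of it.
\<close>

definition inverse_speed :: "nat \<Rightarrow> nat \<Rightarrow> nat \<Rightarrow> nat \<Rightarrow> nat \<Rightarrow> real" where
  "inverse_speed n h D \<gamma> L0 = real ((3 * h) ^ n * L0 ^ \<gamma>) + real (4 * D * (3 * h) ^ n)"

text \<open>
  The delay at scale \<open>L\<close> is a constant times \<open>L ^ (n + 1 + 2 a)\<close>, where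
  \<open>n + 1\<close> is the dimension. By the assumption on \<open>\<gamma>\<close> this is at
  most \<open>L ^ \<gamma> / L\<close>, a proportion \<open>1 / L\<close> of the next length.
  These proportions are dominated by a geometric series, so the speed does not degenerate.
\<close>

lemma crossing_time_le:
  assumes L0: "2 \<le> L0" and \<gamma>: "n + 1 + 2 * a < \<gamma>"
  shows "real (crossing_time n a h D \<gamma> L0 k) \<le> inverse_speed n h D \<gamma> L0 * real (length_scale \<gamma> L0 k)"
proof -
  define V0 where "V0 = real ((3 * h) ^ n * L0 ^ \<gamma>)"
  define C where "C = real (4 * D * (3 * h) ^ n)"
  have nonneg: "0 \<le> V0" "0 \<le> C" by (simp_all add: V0_def C_def)
  have "real (crossing_time n a h D \<gamma> L0 k) \<le> (V0 + C * (1 - (1/2) ^ k)) * real (length_scale \<gamma> L0 k)"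
  proof (induction k)
    case 0
    have "crude_time n a h L0 = (3 * h) ^ n * L0 ^ (n + a + 1)"
      by (simp add: crude_time_def height_def power_mult_distrib power_add)
    also have "\<dots> \<le> (3 * h) ^ n * L0 ^ (\<gamma> + 1)"
      using L0 \<gamma> by (intro mult_left_mono power_increasing) auto
    finally have "real (crude_time n a h L0) \<le> real ((3 * h) ^ n * L0 ^ (\<gamma> + 1))"
      by (simp only: of_nat_le_iff)
    then show ?case by (simp add: V0_def mult_ac)
  next
    case (Suc k)
    define L where "L = length_scale \<gamma> L0 k"
    define T where "T = crossing_time n a h D \<gamma> L0 k"
    have L: "2 ^ (k + 1) \<le> L" "1 \<le> L" using length_scale_ge[of L0 \<gamma> k] L0 \<gamma> by (auto simp: L_def)
    have "real (L ^ (\<gamma> - 1)) * real T \<le> real (L ^ (\<gamma> - 1)) * ((V0 + C * (1 - (1/2) ^ k)) * real L)"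
      using Suc by (intro mult_left_mono) (auto simp: T_def L_def)
    also have "\<dots> = (V0 + C * (1 - (1/2) ^ k)) * real (L ^ \<gamma>)"
      using \<gamma> by (cases \<gamma>) auto
    finally have main: "real (L ^ (\<gamma> - 1)) * real T \<le> (V0 + C * (1 - (1/2) ^ k)) * real (L ^ \<gamma>)" .
    have "D * (4 * L ^ a) * crude_time n a h L = 4 * D * (3 * h) ^ n * L ^ (n + 1 + 2 * a)"
    proof -
      have "L ^ (2 * a) = L ^ a * L ^ a" by (simp add: mult_2 power_add)
      then show ?thesis by (simp add: crude_time_def height_def power_mult_distrib power_add mult_ac)
    qed
    then have delay_eq: "real (D * (4 * L ^ a) * crude_time n a h L) = C * real (L ^ (n + 1 + 2 * a))"
      by (simp only: C_def of_nat_mult)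
    have "2 ^ (k + 1) * L ^ (n + 1 + 2 * a) \<le> L * L ^ (n + 1 + 2 * a)"
      using L by (intro mult_right_mono) auto
    also have "\<dots> = L ^ (n + 2 + 2 * a)" by simp
    also have "\<dots> \<le> L ^ \<gamma>" using L \<gamma> by (intro power_increasing) auto
    finally have "real (2 ^ (k + 1) * L ^ (n + 1 + 2 * a)) \<le> real (L ^ \<gamma>)" by (simp only: of_nat_le_iff)
    then have "real (L ^ (n + 1 + 2 * a)) \<le> (1/2) ^ (k + 1) * real (L ^ \<gamma>)"
      by (simp add: field_simps)
    then have "C * real (L ^ (n + 1 + 2 * a)) \<le> C * ((1/2) ^ (k + 1) * real (L ^ \<gamma>))"
      using nonneg by (intro mult_left_mono)
    then have "real (crossing_time n a h D \<gamma> L0 (Suc k))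
        \<le> (V0 + C * (1 - (1/2) ^ k)) * real (L ^ \<gamma>) + C * ((1/2) ^ (k + 1) * real (L ^ \<gamma>))"
      using main delay_eq by (simp add: L_def T_def)
    also have "\<dots> = (V0 + C * (1 - (1/2) ^ Suc k)) * real (L ^ \<gamma>)"
      by (simp add: algebra_simps)
    finally show ?case by (simp only: length_scale_Suc L_def)
  qed
  also have "\<dots> \<le> (V0 + C) * real (length_scale \<gamma> L0 k)"
    using nonneg by (intro mult_right_mono add_left_mono mult_left_le) auto
  finally show ?thesis by (simp add: inverse_speed_def V0_def C_def)
qed

text \<open>
  A box of the next scale contains, up to a constant factor, \<open>L\<close> to this power small
  boxes.
\<close>

definition count_exponent :: "nat \<Rightarrow> nat \<Rightarrow> real" where
  "count_exponent n \<gamma> = real (n + 1) * (real \<gamma> - 1)"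

lemma count_powr:
  assumes "1 \<le> L" "1 \<le> \<gamma>"
  shows "real (L ^ (\<gamma> - 1)) ^ (n + 1) = real L powr count_exponent n \<gamma>"
proof -
  have "real ((\<gamma> - 1) * (n + 1)) = count_exponent n \<gamma>"
    unfolding count_exponent_def of_nat_mult using assms(2) by (simp add: of_nat_diff)
  moreover have "real (L ^ (\<gamma> - 1)) ^ (n + 1) = real L ^ ((\<gamma> - 1) * (n + 1))"
    by (simp only: of_nat_power power_mult)
  moreover have "\<dots> = real L powr real ((\<gamma> - 1) * (n + 1))"
    using assms(1) by (subst powr_realpow) auto
  ultimately show ?thesis by simp
qed

text \<open>
  The exponent \<open>r\<close> at which the probability of a slow box decays has to survive the
  recursion. With \<open>e\<close> the exponent of the number of boxes, \<open>D\<close>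
  independent slow boxes lead to \<open>D e - D r < - \<gamma> r\<close> as a requirement, that
  is, \<open>r > e D / (D - \<gamma>)\<close>. The error of the mixing condition and the finite
  size criterion allow every \<open>r < 2 e\<close>. As \<open>D > 2 \<gamma>\<close>, there is
  room between the two bounds, and \<open>r\<close> is taken halfway. The choice does not involve
  \<open>\<rho>\<close>, \<open>\<alpha>\<close> or \<open>a\<close>.
\<close>

definition decay :: "nat \<Rightarrow> nat \<Rightarrow> nat \<Rightarrow> real" where
  "decay n D \<gamma> = count_exponent n \<gamma> * (real D / (real D - real \<gamma>) + 2) / 2"

text \<open>
  The margins left by the two bounds; a power of \<open>L\<close> with this exponent has to absorb
  the constants of the recursion.
\<close>

definition slack :: "nat \<Rightarrow> nat \<Rightarrow> nat \<Rightarrow> real" where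
  "slack n D \<gamma> = min (real \<gamma> * (2 * count_exponent n \<gamma> - decay n D \<gamma>))
      ((real D - real \<gamma>) * decay n D \<gamma> - real D * count_exponent n \<gamma>)"

lemma exponents:
  assumes "2 * \<gamma> < D" "2 \<le> \<gamma>"
  shows "0 < count_exponent n \<gamma>" "count_exponent n \<gamma> < decay n D \<gamma>"
    "decay n D \<gamma> < 2 * count_exponent n \<gamma>" "0 < slack n D \<gamma>"
proof -
  let ?e = "count_exponent n \<gamma>"
  show e: "0 < ?e" using assms by (simp add: count_exponent_def)
  have D: "real D - real \<gamma> > real \<gamma>" "real \<gamma> > 0" using assms by simp_all
  then have frac: "0 < real D / (real D - real \<gamma>)" "real D / (real D - real \<gamma>) < 2"
    using assms by (auto simp: field_simps)
  show "?e < decay n D \<gamma>"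
  proof -
    have "?e * 2 < ?e * (real D / (real D - real \<gamma>) + 2)" using e frac by (intro mult_strict_left_mono) auto
    then show ?thesis by (simp add: decay_def)
  qed
  show small: "decay n D \<gamma> < 2 * ?e"
  proof -
    have "?e * (real D / (real D - real \<gamma>) + 2) < ?e * 4" using e frac by (intro mult_strict_left_mono) auto
    then show ?thesis by (simp add: decay_def)
  qed
  have "(real D - real \<gamma>) * decay n D \<gamma> - real D * ?e = ?e * (real D - 2 * real \<gamma>) / 2"
    using D by (simp add: decay_def field_simps)
  moreover have "0 < ?e * (real D - 2 * real \<gamma>) / 2" using e assms by simp
  ultimately show "0 < slack n D \<gamma>" using small D by (simp add: slack_def)
qed

text \<open>
  Each of the three contributions (a box that fails to cross in the crude time, \<open>D\<close>
  slow boxes that are treated as independent, and the error of the mixing condition) is at most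
  \<open>A ^ D\<close> times the target divided by \<open>L ^ slack\<close>.
\<close>

lemma decay_recursion:
  fixes L :: real
  assumes D: "2 * \<gamma> < D" "2 \<le> \<gamma>" and L: "1 \<le> L" and A: "1 \<le> A"
    and absorb: "3 * A ^ D \<le> L powr slack n D \<gamma>"
    and \<rho>: "\<rho> > count_exponent n \<gamma> * (1 + 2 * real \<gamma>)"
    and mixing: "\<sigma> > 2 * real D * count_exponent n \<gamma>"
    and p: "0 \<le> p" "p \<le> L powr (- decay n D \<gamma>)" and q: "q \<le> L powr (- \<rho>)"
    and B: "B = A * L powr count_exponent n \<gamma>"
  shows "B * q + B ^ D * (p ^ D + L powr (- \<sigma>)) \<le> L powr (- (real \<gamma> * decay n D \<gamma>))"
proof -
  define e where "e = count_exponent n \<gamma>"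
  define r where "r = decay n D \<gamma>"
  define \<delta> where "\<delta> = slack n D \<gamma>"
  define E where "E = L powr (- (real \<gamma> * r) - \<delta>)"
  have e: "0 < e" "r < 2 * e" "0 < \<delta>" using exponents[OF D, of n] by (simp_all add: e_def r_def \<delta>_def)
  have \<delta>: "\<delta> \<le> real \<gamma> * (2 * e - r)" "\<delta> \<le> (real D - real \<gamma>) * r - real D * e"
    unfolding \<delta>_def slack_def e_def r_def by simp_all
  have AD: "A \<le> A ^ D" using A D by (intro self_le_power) auto
  have BD: "B ^ D = A ^ D * L powr (real D * e)"
    using L by (simp add: B e_def power_mult_distrib powr_power mult.commute)
  have E0: "0 \<le> E" by (simp add: E_def)
  have two: "2 * real \<gamma> * e \<le> real D * e" using D e(1) by (intro mult_right_mono) auto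
  have "B * q \<le> B * L powr (- \<rho>)" using q A by (intro mult_left_mono) (auto simp: B)
  also have "\<dots> = A * L powr (e - \<rho>)" by (simp add: B e_def powr_add[symmetric])
  also have "\<dots> \<le> A ^ D * E"
    unfolding E_def using AD A L \<delta>(1) \<rho>
    by (intro mult_mono powr_mono) (auto simp: e_def algebra_simps)
  finally have t1: "B * q \<le> A ^ D * E" .
  have "p ^ D \<le> (L powr (- r)) ^ D" using p by (intro power_mono) (auto simp: r_def)
  also have "\<dots> = L powr (- (real D * r))" using L by (simp add: powr_power mult.commute)
  finally have "B ^ D * p ^ D \<le> A ^ D * L powr (real D * e) * L powr (- (real D * r))"
    unfolding BD using A by (intro mult_left_mono) auto
  also have "\<dots> = A ^ D * L powr (real D * e - real D * r)" by (simp add: powr_diff powr_minus_divide)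
  also have "\<dots> \<le> A ^ D * E"
    unfolding E_def using A L \<delta>(2) by (intro mult_left_mono powr_mono) (auto simp: algebra_simps)
  finally have t2: "B ^ D * p ^ D \<le> A ^ D * E" .
  have "B ^ D * L powr (- \<sigma>) = A ^ D * L powr (real D * e - \<sigma>)"
    by (simp add: BD powr_diff powr_minus_divide)
  also have "\<dots> \<le> A ^ D * E"
    unfolding E_def using A L \<delta>(1) two mixing
    by (intro mult_left_mono powr_mono) (auto simp: e_def algebra_simps)
  finally have t3: "B ^ D * L powr (- \<sigma>) \<le> A ^ D * E" .
  have "B * q + B ^ D * (p ^ D + L powr (- \<sigma>)) \<le> 3 * A ^ D * E"
    using t1 t2 t3 by (simp add: distrib_left)
  also have "\<dots> \<le> L powr \<delta> * E" using absorb E0 by (intro mult_right_mono) (simp_all add: \<delta>_def)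
  also have "\<dots> = L powr (- (real \<gamma> * r))" by (simp add: E_def powr_add[symmetric])
  finally show ?thesis by (simp add: r_def)
qed

context random_dynamics
begin

text \<open>
  At the initial scale the time is the crude one, and the finite size criterion applies directly.
  At later scales it enters again, as the bound on small boxes that are not crossed in the crude
  time; this is where it has to beat the number of boxes on top of the decay \<open>\<gamma>
  r\<close>.
\<close>

lemma crossing_probability:
  fixes D \<gamma> a h L0 :: nat
  assumes D: "2 * \<gamma> < D" and \<gamma>: "CARD('n) + 1 + 2 * a < \<gamma>" and a: "1 \<le> a" and h: "0 < h"
    and L0: "2 \<le> L0" "h \<le> L0" "c1 \<le> real L0" "c2 \<le> real L0"
    and absorb: "3 * (3 ^ CARD('n)) ^ D \<le> real L0 powr slack CARD('n) D \<gamma>"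
    and \<rho>: "\<rho> > count_exponent CARD('n) \<gamma> * (1 + 2 * real \<gamma>)"
    and \<alpha>: "\<alpha> * (real a + 1) > 2 * real D * count_exponent CARD('n) \<gamma>"
    and mix: "Mix P D \<alpha> c1" and fs: "FS F a P h \<rho> c2"
  shows "prob (bad a h (length_scale \<gamma> L0 k) (crossing_time CARD('n) a h D \<gamma> L0 k) 0)
    \<le> real (length_scale \<gamma> L0 k) powr (- decay CARD('n) D \<gamma>)"
proof (induction k)
  case 0
  have \<gamma>2: "2 \<le> \<gamma>" using \<gamma> by simp
  note ex = exponents[OF D \<gamma>2, of "CARD('n)"]
  have "count_exponent CARD('n) \<gamma> * 2 \<le> count_exponent CARD('n) \<gamma> * (1 + 2 * real \<gamma>)"
    using ex(1) \<gamma>2 by (intro mult_left_mono) auto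
  then have "decay CARD('n) D \<gamma> \<le> \<rho>" using ex(3) \<rho> by linarith
  then have "real L0 powr (- \<rho>) \<le> real L0 powr (- decay CARD('n) D \<gamma>)"
    using L0(1) by (intro powr_mono) auto
  then show ?case using prob_crude_bad[OF fs L0(4)] by simp
next
  case (Suc k)
  have \<gamma>2: "2 \<le> \<gamma>" using \<gamma> by simp
  define L where "L = length_scale \<gamma> L0 k"
  define T where "T = crossing_time CARD('n) a h D \<gamma> L0 k"
  define K where "K = crude_time CARD('n) a h L"
  define B where "B = 3 ^ CARD('n) * real (L ^ (\<gamma> - 1)) ^ (CARD('n) + 1)"
  have L0L: "L0 \<le> L" unfolding L_def using length_scale_ge[OF L0(1) \<gamma>2] by blast
  then have L: "2 \<le> L" "h \<le> L" "c1 \<le> real L" "c2 \<le> real L" using L0 by linarith+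
  have B: "B = 3 ^ CARD('n) * real L powr count_exponent CARD('n) \<gamma>"
    unfolding B_def using L \<gamma>2 by (subst count_powr) auto
  have "real L0 powr slack CARD('n) D \<gamma> \<le> real L powr slack CARD('n) D \<gamma>"
    using L0L L0(1) exponents(4)[OF D \<gamma>2, of "CARD('n)"] by (intro powr_mono2) auto
  then have absorb': "3 * (3 ^ CARD('n)) ^ D \<le> real L powr slack CARD('n) D \<gamma>" using absorb by linarith
  have "real (height a L) = real L powr (real a + 1)"
    using L by (simp add: height_def powr_add powr_realpow)
  then have height: "real (height a L) powr (- \<alpha>) = real L powr (- (\<alpha> * (real a + 1)))"
    by (simp add: powr_powr mult.commute)
  have "prob (bad a h (L ^ \<gamma>) (L ^ (\<gamma> - 1) * T + D * (4 * L ^ a) * K) 0)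
      \<le> B * prob (bad a h L K 0) + B ^ D * (prob (bad a h L T 0) ^ D + real (height a L) powr (- \<alpha>))"
    unfolding B_def K_def by (rule prob_bad_next_scale[OF L(1) \<gamma>2 a h L(2) mix L(3)])
  also have "\<dots> \<le> real L powr (- (real \<gamma> * decay CARD('n) D \<gamma>))"
    unfolding height
  proof (rule decay_recursion[OF D \<gamma>2 _ _ absorb' \<rho> \<alpha> _ _ _ B])
    show "prob (bad a h L T 0) \<le> real L powr (- decay CARD('n) D \<gamma>)"
      using Suc by (simp add: L_def T_def)
    show "prob (bad a h L K 0) \<le> real L powr (- \<rho>)"
      unfolding K_def by (rule prob_crude_bad[OF fs L(4)])
  qed (use L in auto)
  also have "\<dots> = real (L ^ \<gamma>) powr (- decay CARD('n) D \<gamma>)"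
  proof -
    have "real (L ^ \<gamma>) = real L powr real \<gamma>" using L by (simp add: powr_realpow)
    then show ?thesis by (simp add: powr_powr)
  qed
  finally show ?case by (simp add: length_scale_Suc L_def T_def K_def)
qed

section \<open>Positive speed of the flat surface\<close>

text \<open>
  Starting from a flat surface, one climbs \<open>N\<close> levels above the origin inside a
  pyramid of boxes over a base of \<open>2 N\<close> cells; this is the event that one of these
  boxes is slow.
\<close>

definition cone_bad :: "nat \<Rightarrow> nat \<Rightarrow> nat \<Rightarrow> nat \<Rightarrow> nat \<Rightarrow> 'n environment set" where
  "cone_bad a h L T N = (\<Union>p\<in>{i. \<forall>k. i $ k \<in> {- int N..<int N}} \<times> {..<N}. bad a h L T (corner h L (fst p) (snd p)))"

lemma cone_bad_sets: "cone_bad a h L T N \<in> events"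
  unfolding cone_bad_def by (intro sets.finite_UN finite_cartesian_product finite_int_box bad_sets) auto

lemma prob_cone_bad:
  "prob (cone_bad a h L T N) \<le> 3 ^ CARD('n) * real N ^ (CARD('n) + 1) * prob (bad a h L T 0)"
proof -
  let ?I = "{i :: int ^ 'n. \<forall>k. i $ k \<in> {- int N..<int N}} \<times> {..<N}"
  have fin: "finite ?I" by (intro finite_cartesian_product finite_int_box) auto
  have "card ?I = (2 * N) ^ CARD('n) * N"
    by (subst card_cartesian_product, subst finite_int_box(2)) (simp_all add: nat_mult_distrib)
  also have "\<dots> \<le> (3 * N) ^ CARD('n) * N" by (intro mult_right_mono power_mono) auto
  finally have "real (card ?I) \<le> real ((3 * N) ^ CARD('n) * N)" by (simp only: of_nat_le_iff)
  then have card: "real (card ?I) \<le> 3 ^ CARD('n) * real N ^ (CARD('n) + 1)"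
    by (simp add: power_mult_distrib mult_ac)
  have "prob (cone_bad a h L T N) \<le> (\<Sum>p\<in>?I. prob (bad a h L T (corner h L (fst p) (snd p))))"
    unfolding cone_bad_def by (rule finite_measure_subadditive_finite[OF fin]) auto
  also have "\<dots> = (\<Sum>p\<in>?I. prob (bad a h L T 0))"
    by (intro sum.cong refl prob_bad)
  also have "\<dots> = real (card ?I) * prob (bad a h L T 0)"
    by (simp only: sum_constant)
  also have "\<dots> \<le> 3 ^ CARD('n) * real N ^ (CARD('n) + 1) * prob (bad a h L T 0)"
    using card by (intro mult_right_mono) auto
  finally show ?thesis .
qed

lemma flat_climbs:
  assumes \<omega>: "proper \<omega>" "\<omega> \<notin> cone_bad a h L T N" and pos: "0 < h" "0 < L" and J: "J < N"
  shows "above (int (L * J)) (evolution F \<omega> flat_surface (J * T) 0)"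
proof -
  have "above (int (L * J)) (evolution F \<omega> flat_surface (\<Sum>j<J. T) 0)"
  proof (rule climb_levels[where m = "- int N" and M = "int N" and \<omega> = \<omega> and h = h and a = a])
    fix i :: "int ^ 'n" and j assume ij: "j < J" "\<forall>k. - int N \<le> i $ k \<and> i $ k + 3 \<le> int N"
    show "env_in (box_C a h L) (shift (corner h L i j) \<omega>) \<le> shift (corner h L i j) \<omega>"
      by (simp add: le_fun_def env_in_def)
    have "i $ k \<in> {- int N..<int N}" for k using ij(2)[rule_format, of k] by simp
    then have "(i, j) \<in> {i. \<forall>k. i $ k \<in> {- int N..<int N}} \<times> {..<N}" using ij(1) J by simp
    then have "\<omega> \<notin> bad a h L T (corner h L i j)" using \<omega>(2) unfolding cone_bad_def by force
    then show "crosses F a h L T (shift (corner h L i j) \<omega>)" using \<omega>(1) by (simp add: bad_def space_P)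
  next
    have "int (h * L) * (- int N + int J) \<le> 0" using J by (intro mult_nonneg_nonpos) auto
    moreover have "0 < int (h * L) * (int N - int J)" using J pos by (intro mult_pos_pos) auto
    ultimately show "\<forall>k. int (h * L) * (- int N + int J) \<le> (0 :: int ^ 'n) $ k \<and>
        (0 :: int ^ 'n) $ k < int (h * L) * (int N - int J)" by simp
  qed (use \<omega> pos in \<open>simp_all add: flat_surface_def\<close>)
  then show ?thesis by simp
qed

end

lemma crossing_time_growth:
  assumes "2 \<le> L0" "2 \<le> \<gamma>" "0 < h"
  shows "2 * crossing_time n a h D \<gamma> L0 k \<le> crossing_time n a h D \<gamma> L0 (Suc k)"
    "2 ^ k \<le> crossing_time n a h D \<gamma> L0 k"
proof -
  have growth: "2 * crossing_time n a h D \<gamma> L0 k \<le> crossing_time n a h D \<gamma> L0 (Suc k)" for k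
  proof -
    have "2 \<le> length_scale \<gamma> L0 k" using length_scale_ge[OF assms(1,2), of k] assms(1) by linarith
    moreover have "length_scale \<gamma> L0 k \<le> length_scale \<gamma> L0 k ^ (\<gamma> - 1)"
      using assms calculation by (intro self_le_power) auto
    ultimately have "2 \<le> length_scale \<gamma> L0 k ^ (\<gamma> - 1)" by linarith
    then have "2 * crossing_time n a h D \<gamma> L0 k \<le> length_scale \<gamma> L0 k ^ (\<gamma> - 1) * crossing_time n a h D \<gamma> L0 k"
      by (rule mult_right_mono) simp
    also have "\<dots> \<le> crossing_time n a h D \<gamma> L0 (Suc k)" by simp
    finally show ?thesis .
  qed
  show "2 * crossing_time n a h D \<gamma> L0 k \<le> crossing_time n a h D \<gamma> L0 (Suc k)" by (rule growth)
  show "2 ^ k \<le> crossing_time n a h D \<gamma> L0 k"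
  proof (induction k)
    case 0
    then show ?case using assms by (simp add: crude_time_def height_def Suc_le_eq)
  next
    case (Suc k)
    then show ?case using growth[of k] by (simp del: crossing_time.simps)
  qed
qed

context random_dynamics
begin

text \<open>
  Up to the next crossing time, the good pyramid of scale \<open>L k\<close> is used to climb one
  level per crossing time, at most \<open>N - 1\<close> of them. Rounding to whole levels loses a
  factor two at most, and so does stopping at the top of the pyramid, since \<open>T (Suc
  k)\<close> is at most \<open>V\<close> times the height of \<open>N\<close> levels.
\<close>

lemma ballistic_bound:
  fixes D \<gamma> a h L0 t k :: nat
  assumes \<gamma>: "CARD('n) + 1 + 2 * a < \<gamma>" and L0: "2 \<le> L0" and h: "0 < h" and \<omega>: "proper \<omega>"
  defines "T \<equiv> crossing_time CARD('n) a h D \<gamma> L0" and "L \<equiv> length_scale \<gamma> L0"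
    and "V \<equiv> inverse_speed CARD('n) h D \<gamma> L0"
  assumes good: "\<omega> \<notin> cone_bad a h (L k) (T k) (L k ^ (\<gamma> - 1))"
    and t: "T k \<le> t" "t < T (Suc k)"
  shows "\<exists>z. evolution F \<omega> flat_surface t 0 = Fin z \<and> real t / (2 * V) \<le> real_of_int z"
proof -
  have \<gamma>2: "2 \<le> \<gamma>" using \<gamma> by simp
  define N where "N = L k ^ (\<gamma> - 1)"
  have Lk: "2 \<le> L k" using length_scale_ge[OF L0 \<gamma>2, of k] L0 by (simp add: L_def)
  have N: "2 \<le> N"
  proof -
    have "L k \<le> N" unfolding N_def using Lk \<gamma> by (intro self_le_power) auto
    then show ?thesis using Lk by linarith
  qed
  have Tk: "0 < T k" using crossing_time_growth(2)[OF L0 \<gamma>2 h, of k "CARD('n)" a D]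
    unfolding T_def by (metis gr0I not_less power_not_zero zero_neq_numeral le_zero_eq)
  have LSuc: "L (Suc k) = L k * N"
    unfolding L_def length_scale_Suc N_def using \<gamma>2 by (cases \<gamma>) auto
  have TV: "real (T j) \<le> V * real (L j)" for j
    unfolding T_def L_def V_def using crossing_time_le[OF L0 \<gamma>] .
  have V: "0 < V"
    unfolding V_def inverse_speed_def using h L0 by (intro add_pos_nonneg) auto
  define J where "J = min (t div T k) (N - 1)"
  have "J < N" using N by (simp add: J_def)
  then have "above (int (L k * J)) (evolution F \<omega> flat_surface (J * T k) 0)"
    using good \<omega> h Lk unfolding N_def by (intro flat_climbs) auto
  moreover have "J * T k \<le> t"
  proof -
    have "J * T k \<le> t div T k * T k" by (intro mult_right_mono) (auto simp: J_def)
    also have "\<dots> \<le> t" by simp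
    finally show ?thesis .
  qed
  ultimately have "above (int (L k * J)) (evolution F \<omega> flat_surface t 0)"
    using above_surface_le[OF evolution_increasing[OF \<omega>]] by blast
  then obtain z where z: "evolution F \<omega> flat_surface t 0 = Fin z" "int (L k * J) \<le> z"
    by (auto simp: above_def)
  have time: "real t \<le> 2 * V * real (L k * J)"
  proof (cases "t div T k \<le> N - 1")
    case True
    then have J: "J = t div T k" by (simp add: J_def)
    then have "1 \<le> J" using t(1) Tk by (simp add: Suc_le_eq div_greater_zero_iff)
    have "t = T k * J + t mod T k" "t mod T k < T k" using Tk unfolding J by simp_all
    then have "t < T k * J + T k" by linarith
    moreover have "T k * 1 \<le> T k * J" using \<open>1 \<le> J\<close> by (intro mult_left_mono) auto
    ultimately have "t \<le> 2 * (T k * J)" by linarith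
    then have "real t \<le> real (2 * (T k * J))" by (simp only: of_nat_le_iff)
    also have "\<dots> = 2 * real J * real (T k)" by simp
    also have "\<dots> \<le> 2 * real J * (V * real (L k))" using TV by (intro mult_left_mono) auto
    finally show ?thesis by (simp add: mult_ac)
  next
    case False
    then have "J = N - 1" by (simp add: J_def)
    then have "N \<le> 2 * J" using N by linarith
    then have "L (Suc k) \<le> L k * (2 * J)" unfolding LSuc by (intro mult_left_mono) auto
    then have "real (L (Suc k)) \<le> real (L k * (2 * J))" by (simp only: of_nat_le_iff)
    then have "V * real (L (Suc k)) \<le> V * real (L k * (2 * J))" using V by (intro mult_left_mono) auto
    moreover have "real t \<le> real (T (Suc k))" using t(2) by simp
    ultimately show ?thesis using TV[of "Suc k"] by (simp add: mult_ac)
  qed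
  have "real (L k * J) \<le> real_of_int z" using z(2) by linarith
  then have "2 * V * real (L k * J) \<le> 2 * V * real_of_int z" using V by (intro mult_left_mono) auto
  with time have "real t \<le> 2 * V * real_of_int z" by linarith
  then have "real t / (2 * V) \<le> real_of_int z" using V by (simp add: field_simps)
  then show ?thesis using z(1) by blast
qed

text \<open>
  The probability that the pyramid of scale \<open>L k\<close> is bad is at most a multiple of
  \<open>L k\<close> to the power \<open>e - r < 0\<close>, with \<open>e\<close> the exponent of
  the number of boxes and \<open>r\<close> the decay; this is summable. By the Borel-Cantelli
  lemma all pyramids from some scale on are good, and together their time windows cover all large
  times.
\<close>

lemma liminf_speed:
  fixes D \<gamma> a h L0 :: nat
  assumes D: "2 * \<gamma> < D" and \<gamma>: "CARD('n) + 1 + 2 * a < \<gamma>" and a: "1 \<le> a" and h: "0 < h"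
    and L0: "2 \<le> L0" "h \<le> L0" "c1 \<le> real L0" "c2 \<le> real L0"
    and absorb: "3 * (3 ^ CARD('n)) ^ D \<le> real L0 powr slack CARD('n) D \<gamma>"
    and \<rho>: "\<rho> > count_exponent CARD('n) \<gamma> * (1 + 2 * real \<gamma>)"
    and \<alpha>: "\<alpha> * (real a + 1) > 2 * real D * count_exponent CARD('n) \<gamma>"
    and mix: "Mix P D \<alpha> c1" and fs: "FS F a P h \<rho> c2"
  shows "AE \<omega> in P. ereal (1 / (2 * inverse_speed CARD('n) h D \<gamma> L0))
    \<le> liminf (\<lambda>t. ereal_of_zbar (evolution F \<omega> flat_surface t 0) / ereal (real t))"
proof -
  have \<gamma>2: "2 \<le> \<gamma>" using \<gamma> by simp
  define T where "T = crossing_time CARD('n) a h D \<gamma> L0"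
  define L where "L = length_scale \<gamma> L0"
  define V where "V = inverse_speed CARD('n) h D \<gamma> L0"
  define E where "E k = cone_bad a h (L k) (T k) (L k ^ (\<gamma> - 1))" for k
  define \<beta> where "\<beta> = decay CARD('n) D \<gamma> - count_exponent CARD('n) \<gamma>"
  have \<beta>: "0 < \<beta>" using exponents(2)[OF D \<gamma>2, of "CARD('n)"] by (simp add: \<beta>_def)
  have bound: "prob (E k) \<le> 3 ^ CARD('n) * (2 powr (- \<beta>)) ^ k" for k
  proof -
    have Lk: "2 \<le> L k" "2 ^ (k + 1) \<le> L k"
      using length_scale_ge[OF L0(1) \<gamma>2, of k] L0(1) unfolding L_def by linarith+
    have count: "real (L k ^ (\<gamma> - 1)) ^ (CARD('n) + 1) = real (L k) powr count_exponent CARD('n) \<gamma>"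
      using Lk \<gamma>2 by (intro count_powr) auto
    have "prob (E k) \<le> 3 ^ CARD('n) * real (L k) powr count_exponent CARD('n) \<gamma> * prob (bad a h (L k) (T k) 0)"
      using prob_cone_bad[of a h "L k" "T k" "L k ^ (\<gamma> - 1)"] unfolding E_def count .
    also have "\<dots> \<le> 3 ^ CARD('n) * real (L k) powr count_exponent CARD('n) \<gamma> * real (L k) powr (- decay CARD('n) D \<gamma>)"
      unfolding L_def T_def using crossing_probability[OF D \<gamma> a h L0 absorb \<rho> \<alpha> mix fs]
      by (intro mult_left_mono) auto
    also have "\<dots> = 3 ^ CARD('n) * real (L k) powr (- \<beta>)"
      by (simp add: \<beta>_def mult.assoc powr_add[symmetric])
    also have "\<dots> \<le> 3 ^ CARD('n) * (2 ^ k) powr (- \<beta>)"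
    proof -
      have "2 ^ k \<le> L k" using Lk(2) by simp
      then have "real (2 ^ k) \<le> real (L k)" by (simp only: of_nat_le_iff)
      then show ?thesis using \<beta> by (intro mult_left_mono powr_mono2') auto
    qed
    also have "(2 ^ k) powr (- \<beta>) = (2 powr (- \<beta>)) ^ k"
      by (simp add: powr_powr powr_realpow[symmetric] mult.commute)
    finally show ?thesis .
  qed
  have "2 powr (- \<beta>) < 2 powr (0 :: real)" using \<beta> by (intro powr_less_mono) auto
  then have "summable (\<lambda>k. 3 ^ CARD('n) * (2 powr (- \<beta>)) ^ k)"
    by (intro summable_mult summable_geometric) simp
  then have "summable (\<lambda>k. prob (E k))"
    by (rule summable_comparison_test'[where N = 0]) (use bound in simp)
  then have "AE \<omega> in P. eventually (\<lambda>k. \<omega> \<in> space P - E k) sequentially"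
    using cone_bad_sets by (intro borel_cantelli_AE1) (auto simp: E_def less_top[symmetric])
  then show ?thesis
  proof (rule AE_mp, intro AE_I2 impI)
    fix \<omega> assume \<omega>: "\<omega> \<in> space P" and "eventually (\<lambda>k. \<omega> \<in> space P - E k) sequentially"
    then obtain k0 where k0: "\<And>k. k0 \<le> k \<Longrightarrow> \<omega> \<notin> E k" by (auto simp: eventually_sequentially)
    have prp: "proper \<omega>" using \<omega> by (simp add: space_P)
    have Tmono: "T i \<le> T j" if "i \<le> j" for i j
    proof (rule lift_Suc_mono_le[OF _ that])
      show "T k \<le> T (Suc k)" for k
        using crossing_time_growth(1)[OF L0(1) \<gamma>2 h, of "CARD('n)" a D k] unfolding T_def by linarith
    qed
    have "eventually (\<lambda>t. ereal (1 / (2 * V)) \<le> ereal_of_zbar (evolution F \<omega> flat_surface t 0) / ereal (real t))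
        sequentially"
    proof (rule eventually_sequentiallyI)
      fix t assume t: "Suc (T k0) \<le> t"
      have unbounded: "\<exists>j. t < T j"
      proof
        have "t < 2 ^ t" by (rule less_exp)
        also have "2 ^ t \<le> T t" unfolding T_def by (rule crossing_time_growth(2)[OF L0(1) \<gamma>2 h])
        finally show "t < T t" .
      qed
      define j where "j = (LEAST j. t < T j)"
      have j: "t < T j" unfolding j_def using unbounded by (rule LeastI_ex)
      have "k0 < j"
      proof (rule ccontr)
        assume "\<not> k0 < j"
        then have "T j \<le> T k0" by (intro Tmono) simp
        with j t show False by simp
      qed
      then obtain k where k: "j = Suc k" "k0 \<le> k" by (cases j) auto
      have "\<not> t < T k" using not_less_Least[of k "\<lambda>j. t < T j"] k(1) by (simp add: j_def)
      then have "\<exists>z. evolution F \<omega> flat_surface t 0 = Fin z \<and> real t / (2 * V) \<le> real_of_int z"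
        unfolding V_def using j k k0[of k] unfolding E_def L_def T_def
        by (intro ballistic_bound[OF \<gamma> L0(1) h prp]) auto
      then show "ereal (1 / (2 * V)) \<le> ereal_of_zbar (evolution F \<omega> flat_surface t 0) / ereal (real t)"
        using t by (auto simp: field_simps)
    qed
    then show "ereal (1 / (2 * inverse_speed CARD('n) h D \<gamma> L0))
        \<le> liminf (\<lambda>t. ereal_of_zbar (evolution F \<omega> flat_surface t 0) / ereal (real t))"
      unfolding V_def by (rule Liminf_bounded)
  qed
qed

end

theorem theorem2p2:
  fixes d D h \<gamma> :: nat and \<alpha> c1 c2 :: real
  assumes "d \<ge> 2" and "CARD('n::finite) = d - 1"
    and "D > 2 * \<gamma>" and "h \<ge> 2" and "\<alpha> > 0" and "c1 > 0" and "c2 > 0"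
  shows "\<exists>c>0. \<forall>(a::nat) (\<rho>::real) (P :: 'n environment measure) (F :: 'n update).
           a \<ge> 1 \<longrightarrow>
           \<rho> > 0 \<longrightarrow>
           translation_invariant_law P \<longrightarrow>
           update_function F \<longrightarrow>
           nondecreasing_update F \<longrightarrow>
           (\<forall>u. F u (-\<infinity>) = 0) \<longrightarrow>
           \<gamma> > d + 2 * a \<longrightarrow>
           \<alpha> * (real a + 1) > 2 * real D * real d * (real \<gamma> - 1) \<longrightarrow>
           \<rho> > real d * (real \<gamma> - 1) * (1 + 2 * real \<gamma>) \<longrightarrow>
           Mix P D \<alpha> c1 \<longrightarrow>
           FS F a P h \<rho> c2 \<longrightarrow>
           (AE \<omega> in P. liminf (\<lambda>t. ereal_of_zbar (evolution F \<omega> flat_surface t 0) / ereal (real t)) \<ge> ereal c)"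
proof (cases "2 \<le> \<gamma>")
  case False
  \<comment> \<open>Then \<open>\<gamma> > d + 2 * a\<close> is impossible, and every \<open>c\<close> will do.\<close>
  then show ?thesis by (intro exI[of _ 1]) auto
next
  case \<gamma>: True
  define n where "n = CARD('n)"
  have d: "d = n + 1" using assms(1,2) by (simp add: n_def)
  have slack: "0 < slack n D \<gamma>" using exponents(4)[OF assms(3) \<gamma>] .
  define X :: real where "X = 3 * (3 ^ n) ^ D"
  \<comment> \<open>The initial scale depends on \<open>n\<close>, \<open>D\<close>, \<open>\<gamma>\<close>, \<open>h\<close>, \<open>c1\<close> and \<open>c2\<close> only; beyond \<open>Y\<close> the
    power of \<open>L0\<close> absorbs the constants of the recursion.\<close>
  define Y :: real where "Y = X powr (1 / slack n D \<gamma>)"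
  obtain L0 :: nat where L0': "max (max 2 (real h)) (max (max c1 c2) Y) \<le> real L0"
    using real_arch_simple by blast
  then have L0: "2 \<le> L0" "h \<le> L0" "c1 \<le> real L0" "c2 \<le> real L0" "Y \<le> real L0" by simp_all
  have "X = Y powr slack n D \<gamma>" using slack by (simp add: Y_def X_def powr_powr)
  also have "\<dots> \<le> real L0 powr slack n D \<gamma>" using L0(5) slack by (intro powr_mono2) (auto simp: Y_def)
  finally have absorb: "3 * (3 ^ n) ^ D \<le> real L0 powr slack n D \<gamma>" by (simp add: X_def)
  let ?V = "inverse_speed n h D \<gamma> L0"
  have "0 < ?V" unfolding inverse_speed_def using assms(4) L0(1) by (intro add_pos_nonneg) auto
  show ?thesis
  proof (intro exI[of _ "1 / (2 * ?V)"] conjI allI impI)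
    show "0 < 1 / (2 * ?V)" using \<open>0 < ?V\<close> by simp
    fix a \<rho> and P :: "'n environment measure" and F :: "'n update"
    assume a: "1 \<le> a" and law: "translation_invariant_law P"
      and F: "update_function F" "nondecreasing_update F" "\<forall>u. F u (-\<infinity>) = 0"
      and \<gamma>a: "d + 2 * a < \<gamma>" and \<alpha>: "2 * real D * real d * (real \<gamma> - 1) < \<alpha> * (real a + 1)"
      and \<rho>: "real d * (real \<gamma> - 1) * (1 + 2 * real \<gamma>) < \<rho>"
      and mix: "Mix P D \<alpha> c1" and fs: "FS F a P h \<rho> c2"
    interpret random_dynamics F P
      using law F by unfold_locales auto
    show "AE \<omega> in P. ereal (1 / (2 * ?V))
        \<le> liminf (\<lambda>t. ereal_of_zbar (evolution F \<omega> flat_surface t 0) / ereal (real t))"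
      unfolding n_def
    proof (rule liminf_speed[OF assms(3) _ a _ L0(1-4) _ _ _ mix fs])
      show "CARD('n) + 1 + 2 * a < \<gamma>" using \<gamma>a by (simp add: d n_def)
      show "0 < h" using assms(4) by simp
      show "3 * (3 ^ CARD('n)) ^ D \<le> real L0 powr slack CARD('n) D \<gamma>" using absorb by (simp add: n_def)
      show "count_exponent CARD('n) \<gamma> * (1 + 2 * real \<gamma>) < \<rho>"
        using \<rho> by (simp add: count_exponent_def d n_def)
      show "2 * real D * count_exponent CARD('n) \<gamma> < \<alpha> * (real a + 1)"
        using \<alpha> by (simp add: count_exponent_def d n_def mult.assoc)
    qed
  qed
qed

end
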